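(* The matrices $\mathcal{Y}, \mathcal{P}, \Omega, G, G^*$ are central in $\overline{\mathcal{H}}$; that is, each of them belongs to $\overline{\mathcal H}$ and commutes with every element of $\overline{\mathcal{H}}$.
   Context: Let $h>k\geq 1$ be integers, $\mathbb{F}_q$ a finite field with $q$ elements, $\mathcal{V}$ an $(h+k)$-dimensional vector space over $\mathbb{F}_q$, and $P$ the set of all subspaces of $\mathcal{V}$. Fix $y\in P$ with $\dim y=k$. $\mathrm{Mat}_P(\mathbb{C})$ is the algebra of complex matrices with rows and columns indexed by $P$; $I$ is its identity; $q^{1/2}$ is the positive square root. For $0\le i\le k$, $0\le j\le h$ let $P_{i,j}=\{u\in P\mid \dim(u\cap y)=i,\ \dim u=i+j\}$; these sets partition $P$. For $u,v\in P$, $v$ covers $u$ if $u\subseteq v$ and $\dim v=\dim u+1$. If $v$ covers $u$, then $v$ $/$-covers $u$ if $\dim(v\cap y)=\dim(u\cap y)+1$, and $v$ $\backslash$-covers $u$ if $\dim(v\cap y)=\dim(u\cap y)$. $K_1,K_2$ are the diagonal matrices with $(K_1)_{u,u}=q^{\frac k2-i}$, $(K_2)_{u,u}=q^{j-\frac h2}$ for $u\in P_{i,j}$. $L_1,L_2$ are the $0/1$ matrices with $(L_1)_{u,v}=1$ iff $v$ $/$-covers $u$, $(L_2)_{u,v}=1$ iff $v$ $\backslash$-covers $u$; $R_1=L_1^t$, $R_2=L_2^t$. $\mathcal{H}$ is the subalgebra of $\mathrm{Mat}_P(\mathbb{C})$ generated by $L_1,L_2,R_1,R_2,K_1^{\pm1},K_2^{\pm1}$.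 For $0\le\ell\le h+k$, $E^*_\ell$ is the diagonal matrix with $(u,u)$-entry $1$ if $\dim u=\ell$ and $0$ otherwise, and $\overline{\mathcal H}=\sum_{\ell=0}^{h+k}E^*_\ell\mathcal{H}E^*_\ell$, a subalgebra of $\mathcal{H}$. $F^0,F^+,F^-$ are the $0/1$ matrices such that: $(F^0)_{u,v}=1$ iff $u+v$ $/$-covers both $u$ and $v$, and both $u$ and $v$ $\backslash$-cover $u\cap v$; $(F^+)_{u,v}=1$ iff $u+v$ $\backslash$-covers both $u$ and $v$; $(F^-)_{u,v}=1$ iff both $u$ and $v$ $/$-cover $u\cap v$. Define $$\Omega_0=q^{-\frac{h+k}{2}}\Bigl((q-1)F^{0}K_1^{-1}K_2^{-1}+q^{\frac{h}{2}}K_1^{-1}+q^{\frac{k}{2}}K_2^{-1}-K_1^{-1}K_2^{-1}\Bigr),$$ $$\Omega_1=q^{-\frac{h}{2}}\Bigl(qF^{0}K_2^{-1}+(q-1)F^{-}K_2^{-1}+\tfrac{q^{\frac{k}{2}+1}K_1K_2^{-1}+q^{\frac{h+k}{2}+1}K_1^{-1}-qK_2^{-1}}{q-1}\Bigr)-\tfrac{q}{q-1}I,$$ $$\Omega_2=q^{-\frac{k}{2}}\Bigl(qF^0K_1^{-1}+(q-1)F^{+}K_1^{-1}+\tfrac{q^{\frac{h}{2}+1}K_1^{-1}K_2+q^{\frac{h+k}{2}+1}K_2^{-1}-qK_1^{-1}}{q-1}\Bigr)-\tfrac{q}{q-1}I,$$ and $$\mathcal{Y}=q^{\frac{h+k}{2}}\bigl(K_1K_2^{-1}+K_1^{-1}K_2\bigr)-q^{-1}(q-1)I,\qquad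 \mathcal{P}=q(q-1)^{-2}\Bigl(\mathcal{Y}^2-q^{h+k-2}(q+1)^2I\Bigr),$$ $$\Omega=-q^{\frac{h+k}{2}-1}K_1^{-1}K_2\Bigl((q-1)\Omega_1+(q+1)I\Bigr)-q^{k-1}\Bigl((q-1)\Omega_2+(q+1)I\Bigr),$$ $$\begin{aligned}G=&-(q-1)^{-1}\biggl(q^{\frac{h+k}{2}-1}\Bigl(qK_1^{-1}K_2\mathcal{Y}-q^{\frac{h+k}{2}}(q+1)I\Bigr)\Omega_1+q^{k-1}\Bigl(q\mathcal{Y}-q^{\frac{h+k}{2}}(q+1)K_1^{-1}K_2\Bigr)\Omega_2\biggr)\\&-(q+1)(q-1)^{-2}\biggl(\Bigl(q^{\frac{h+k}{2}}K_1^{-1}K_2+q^k I\Bigr)\mathcal{Y}-q^{\frac{h+k}{2}-1}(q+1)\Bigl(q^{k}K_1^{-1}K_2+q^{\frac{h+k}{2}}I\Bigr)\biggr),\end{aligned}$$ $$G^*=q^{\frac{h+3k}{2}-1}(q+1)\Omega_0K_1^{-1}K_2.$$ *)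

theory Defs
  imports "HOL-Analysis.Analysis"
begin

(* Only the additive group of the space is given by the type 'v; its scalar multiplication is the
   locale parameter scale.  The space is UNIV :: 'v set.  The sort constraint finite on 'v is no
   restriction, since a finite-dimensional space over a finite field is finite; it makes 'v set an
   admissible index type for matrices. *)

locale subspace_lattice = vector_space scale
  for scale :: "'a::{field,finite} \<Rightarrow> 'v::{ab_group_add,finite} \<Rightarrow> 'v" +
  fixes q h k :: nat
    and y :: "'v set"
  assumes card_field: "CARD('a) = q"
    and k_ge_1: "1 \<le> k"
    and k_less_h: "k < h"
    and dim_space: "dim (UNIV :: 'v set) = h + k"
    and subspace_y: "subspace y"
    and dim_y: "dim y = k"
begin

definition P :: "'v set set"
  where "P = {u. subspace u}"

definition covers :: "'v set \<Rightarrow> 'v set \<Rightarrow> bool"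
  where "covers v u \<longleftrightarrow> u \<in> P \<and> v \<in> P \<and> u \<subseteq> v \<and> dim v = dim u + 1"

definition slash_covers :: "'v set \<Rightarrow> 'v set \<Rightarrow> bool"
  where "slash_covers v u \<longleftrightarrow> covers v u \<and> dim (v \<inter> y) = dim (u \<inter> y) + 1"

definition backslash_covers :: "'v set \<Rightarrow> 'v set \<Rightarrow> bool"
  where "backslash_covers v u \<longleftrightarrow> covers v u \<and> dim (v \<inter> y) = dim (u \<inter> y)"

definition sum_space :: "'v set \<Rightarrow> 'v set \<Rightarrow> 'v set"
  where "sum_space u v = {a + b |a b. a \<in> u \<and> b \<in> v}"

(* Mat_P(C) is realised inside the library matrices indexed by all subsets of the space, as the
   set of those matrices whose entries vanish outside P x P.  Sums, products ** and transposes of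
   such matrices are those of Mat_P(C), but the identity of Mat_P(C) is Id_P, not mat 1. *)

definition MatP :: "(complex^'v set^'v set) set"
  where "MatP = {A. \<forall>u v. A $ u $ v \<noteq> 0 \<longrightarrow> u \<in> P \<and> v \<in> P}"

definition diag_P :: "('v set \<Rightarrow> real) \<Rightarrow> complex^'v set^'v set"
  where "diag_P f = (\<chi> u v. if u \<in> P \<and> u = v then complex_of_real (f u) else 0)"

definition rel_mat :: "('v set \<Rightarrow> 'v set \<Rightarrow> bool) \<Rightarrow> complex^'v set^'v set"
  where "rel_mat r = (\<chi> u v. if u \<in> P \<and> v \<in> P \<and> r u v then 1 else 0)"

definition cscale :: "complex \<Rightarrow> complex^'v set^'v set \<Rightarrow> complex^'v set^'v set"
  where "cscale c A = (\<chi> u v. c * A $ u $ v)"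

definition Id_P :: "complex^'v set^'v set"
  where "Id_P = diag_P (\<lambda>u. 1)"

(* u lies in P_{i,j} for i = idx_i u and j = idx_j u; no truncation since dim (u \<inter> y) \<le> dim u. *)

definition idx_i :: "'v set \<Rightarrow> nat"
  where "idx_i u = dim (u \<inter> y)"

definition idx_j :: "'v set \<Rightarrow> nat"
  where "idx_j u = dim u - dim (u \<inter> y)"

abbreviation qp :: "real \<Rightarrow> real"
  where "qp e \<equiv> real q powr e"

definition K1 :: "complex^'v set^'v set"
  where "K1 = diag_P (\<lambda>u. qp (k / 2 - idx_i u))"

definition K2 :: "complex^'v set^'v set"
  where "K2 = diag_P (\<lambda>u. qp (idx_j u - h / 2))"

definition K1inv :: "complex^'v set^'v set"
  where "K1inv = diag_P (\<lambda>u. inverse (qp (k / 2 - idx_i u)))"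

definition K2inv :: "complex^'v set^'v set"
  where "K2inv = diag_P (\<lambda>u. inverse (qp (idx_j u - h / 2)))"

definition L1 :: "complex^'v set^'v set"
  where "L1 = rel_mat (\<lambda>u v. slash_covers v u)"

definition L2 :: "complex^'v set^'v set"
  where "L2 = rel_mat (\<lambda>u v. backslash_covers v u)"

definition R1 :: "complex^'v set^'v set"
  where "R1 = transpose L1"

definition R2 :: "complex^'v set^'v set"
  where "R2 = transpose L2"

definition subalgebra_P :: "(complex^'v set^'v set) set \<Rightarrow> bool"
  where "subalgebra_P S \<longleftrightarrow> S \<subseteq> MatP \<and> Id_P \<in> S \<and>
    (\<forall>A\<in>S. \<forall>B\<in>S. A + B \<in> S) \<and> (\<forall>c. \<forall>A\<in>S. cscale c A \<in> S) \<and>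
    (\<forall>A\<in>S. \<forall>B\<in>S. A ** B \<in> S)"

definition H_alg :: "(complex^'v set^'v set) set"
  where "H_alg = subalgebra_P hull {L1, L2, R1, R2, K1, K1inv, K2, K2inv}"

definition Estar :: "nat \<Rightarrow> complex^'v set^'v set"
  where "Estar l = diag_P (\<lambda>u. if dim u = l then 1 else 0)"

definition H_bar :: "(complex^'v set^'v set) set"
  where "H_bar = {\<Sum>l\<le>h + k. Estar l ** A l ** Estar l |A. \<forall>l\<le>h + k. A l \<in> H_alg}"

definition F_zero :: "complex^'v set^'v set"
  where "F_zero = rel_mat (\<lambda>u v.
    slash_covers (sum_space u v) u \<and> slash_covers (sum_space u v) v \<and>
    backslash_covers u (u \<inter> v) \<and> backslash_covers v (u \<inter> v))"

definition F_plus :: "complex^'v set^'v set"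
  where "F_plus = rel_mat (\<lambda>u v.
    backslash_covers (sum_space u v) u \<and> backslash_covers (sum_space u v) v)"

definition F_minus :: "complex^'v set^'v set"
  where "F_minus = rel_mat (\<lambda>u v. slash_covers u (u \<inter> v) \<and> slash_covers v (u \<inter> v))"

definition Omega0 :: "complex^'v set^'v set"
  where "Omega0 = qp (- real (h + k) / 2) *\<^sub>R
    ((real q - 1) *\<^sub>R (F_zero ** K1inv ** K2inv) + qp (h / 2) *\<^sub>R K1inv
      + qp (k / 2) *\<^sub>R K2inv - K1inv ** K2inv)"

definition Omega1 :: "complex^'v set^'v set"
  where "Omega1 = qp (- real h / 2) *\<^sub>R
    (real q *\<^sub>R (F_zero ** K2inv) + (real q - 1) *\<^sub>R (F_minus ** K2inv)
      + (1 / (real q - 1)) *\<^sub>R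
        (qp (k / 2 + 1) *\<^sub>R (K1 ** K2inv) + qp ((h + k) / 2 + 1) *\<^sub>R K1inv - real q *\<^sub>R K2inv))
    - (real q / (real q - 1)) *\<^sub>R Id_P"

definition Omega2 :: "complex^'v set^'v set"
  where "Omega2 = qp (- real k / 2) *\<^sub>R
    (real q *\<^sub>R (F_zero ** K1inv) + (real q - 1) *\<^sub>R (F_plus ** K1inv)
      + (1 / (real q - 1)) *\<^sub>R
        (qp (h / 2 + 1) *\<^sub>R (K1inv ** K2) + qp ((h + k) / 2 + 1) *\<^sub>R K2inv - real q *\<^sub>R K1inv))
    - (real q / (real q - 1)) *\<^sub>R Id_P"

definition Ycal :: "complex^'v set^'v set"
  where "Ycal = qp ((h + k) / 2) *\<^sub>R (K1 ** K2inv + K1inv ** K2)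
    - (inverse (real q) * (real q - 1)) *\<^sub>R Id_P"

definition Pcal :: "complex^'v set^'v set"
  where "Pcal = (real q * inverse ((real q - 1)\<^sup>2)) *\<^sub>R
    (Ycal ** Ycal - (qp (real h + real k - 2) * (real q + 1)\<^sup>2) *\<^sub>R Id_P)"

definition Omega :: "complex^'v set^'v set"
  where "Omega =
    - (qp ((h + k) / 2 - 1) *\<^sub>R
        (K1inv ** K2 ** ((real q - 1) *\<^sub>R Omega1 + (real q + 1) *\<^sub>R Id_P)))
    - qp (real k - 1) *\<^sub>R ((real q - 1) *\<^sub>R Omega2 + (real q + 1) *\<^sub>R Id_P)"

definition G :: "complex^'v set^'v set"
  where "G =
    - (inverse (real q - 1) *\<^sub>R
        (qp ((h + k) / 2 - 1) *\<^sub>R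
          ((real q *\<^sub>R (K1inv ** K2 ** Ycal) - (qp ((h + k) / 2) * (real q + 1)) *\<^sub>R Id_P) ** Omega1)
        + qp (real k - 1) *\<^sub>R
          ((real q *\<^sub>R Ycal - (qp ((h + k) / 2) * (real q + 1)) *\<^sub>R (K1inv ** K2)) ** Omega2)))
    - ((real q + 1) * inverse ((real q - 1)\<^sup>2)) *\<^sub>R
        ((qp ((h + k) / 2) *\<^sub>R (K1inv ** K2) + qp (real k) *\<^sub>R Id_P) ** Ycal
        - (qp ((h + k) / 2 - 1) * (real q + 1)) *\<^sub>R
          (qp (real k) *\<^sub>R (K1inv ** K2) + qp ((h + k) / 2) *\<^sub>R Id_P))"

definition Gstar :: "complex^'v set^'v set"
  where "Gstar = (qp ((h + 3 * k) / 2 - 1) * (real q + 1)) *\<^sub>R (Omega0 ** K1inv ** K2)"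

lemma q_pos: "real q > 0"
  using card_field zero_less_card_finite[where 'a = 'a] by simp

lemma diag_P_mult: "diag_P f ** diag_P g = diag_P (\<lambda>u. f u * g u)"
proof -
  have "(\<Sum>w\<in>UNIV. (if u \<in> P \<and> u = w then complex_of_real (f u) else 0)
          * (if w \<in> P \<and> w = v then complex_of_real (g w) else 0))
      = (if u \<in> P \<and> u = v then complex_of_real (f u * g u) else 0)" (is "sum ?s _ = _") for u v
  proof -
    have "sum ?s UNIV = sum ?s {u}"
      by (rule sum.mono_neutral_right) auto
    then show ?thesis by (cases "u = v") auto
  qed
  then show ?thesis
    by (simp add: diag_P_def matrix_matrix_mult_def vec_eq_iff)
qed

lemma K_inverses:
  "K1 ** K1inv = Id_P" "K1inv ** K1 = Id_P" "K2 ** K2inv = Id_P" "K2inv ** K2 = Id_P"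
  using q_pos by (simp_all add: K1_def K2_def K1inv_def K2inv_def Id_P_def diag_P_mult)

end

end

theory Submission
  imports Defs
begin

text \<open>
  Call the pair \<open>(i, j)\<close> with \<open>u \<in> P\<^sub>i\<^sub>j\<close> the type of \<open>u\<close>. Everything is built from
  \<open>\<Omega>\<^sub>0, \<Omega>\<^sub>1, \<Omega>\<^sub>2\<close> and from \<open>K\<^sub>1 K\<^sub>2\<inverse>\<close>, \<open>K\<^sub>1\<inverse> K\<^sub>2\<close>, whose entries depend on \<open>dim u = i + j\<close> only.
  The latter two are scalars on each block \<open>E\<^sub>l\<close>, and so commute with every \<open>E\<^sub>l A E\<^sub>l\<close>. The
  former three turn out to commute with all of \<open>\<H>\<close> and, as they preserve types, with all \<open>E\<^sub>l\<close>.
  Members of \<open>\<H>\<close> that commute with all \<open>E\<^sub>l A E\<^sub>l\<close>, \<open>A \<in> \<H>\<close>, form an algebra (below: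
  \<open>block_centre\<close>) inside the centre of the block algebra, and the five matrices are polynomials
  in the five matrices just named.

  That the \<open>\<Omega>\<close>s are central in \<open>\<H>\<close> needs no cubic relation to be counted. Diamond arguments in the
  subspace lattice give the quadratic relations \<open>L\<^sub>2 L\<^sub>1 = q L\<^sub>1 L\<^sub>2\<close>, \<open>L\<^sub>1 R\<^sub>2 = R\<^sub>2 L\<^sub>1\<close>, and
  write each of \<open>L\<^sub>1 R\<^sub>1\<close>, \<open>R\<^sub>1 L\<^sub>1\<close>, \<open>L\<^sub>2 R\<^sub>2\<close>, \<open>R\<^sub>2 L\<^sub>2\<close> as a diagonal matrix (the number of covers
  or cocovers of a given kind) plus a sum of \<open>F\<^sup>0, F\<^sup>+, F\<^sup>-\<close>. In particular \<open>F\<^sup>0\<close> has two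
  expressions, and
  \<open>\<Phi> = (q - 1) F\<^sup>0 + q^j + q^(k - i) - 1\<close> equals both
  \<open>(q - 1) (R\<^sub>2 L\<^sub>2 - L\<^sub>2 R\<^sub>2) + q^(h + k - i - j)\<close> and \<open>(q - 1) (L\<^sub>1 R\<^sub>1 - R\<^sub>1 L\<^sub>1) + q^(i + j)\<close>.
  The quadratic relations move \<open>L\<^sub>1\<close> through the first form and \<open>L\<^sub>2\<close> through the second, so
  \<open>\<Phi> L\<^sub>1 = q L\<^sub>1 \<Phi>\<close> and \<open>q \<Phi> L\<^sub>2 = L\<^sub>2 \<Phi>\<close>. Up to scalars, \<open>\<Omega>\<^sub>1\<close> and \<open>\<Omega>\<^sub>2\<close> are twists of Casimir-like
  elements \<open>\<Psi>\<^sub>1\<close> and \<open>\<Psi>\<^sub>2\<close>; for instance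
  \<open>\<Psi>\<^sub>1 = \<Phi> + (q - 1)\<^sup>2 L\<^sub>1 R\<^sub>1 + diagonal = q \<Phi> + (q - 1)\<^sup>2 R\<^sub>1 L\<^sub>1 + diagonal\<close>,
  and multiplying the first form by \<open>L\<^sub>1\<close> on the right and the second on the left gives the same
  matrix. Diagonal factors remove the remaining powers of \<open>q\<close>. All of these matrices are symmetric,
  so commutation with \<open>R\<^sub>1, R\<^sub>2\<close> follows by transposition.
\<close>

section \<open>Subspaces of a vector space over a finite field\<close>

context subspace_lattice begin

sublocale fin: finite_dimensional_vector_space scale "extend_basis {}"
proof
  show "finite (extend_basis {})" by simp
  show "independent (extend_basis {})" by (rule independent_extend_basis[OF independent_empty])
  show "span (extend_basis {}) = UNIV" by (rule span_extend_basis[OF independent_empty])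
qed

lemma q_gt_1: "1 < real q"
proof -
  have "card {0::'a, 1} \<le> CARD('a)" by (rule card_mono) auto
  then show ?thesis using card_field by simp
qed

lemma card_subspace: assumes "subspace u" shows "real (card u) = real q ^ dim u"
proof -
  obtain B where B: "B \<subseteq> u" "independent B" "u \<subseteq> span B" "card B = dim u"
    using basis_exists by blast
  have spB: "span B = u" using B assms by (simp add: span_minimal subset_antisym)
  have finB: "finite B" by simp
  let ?F = "B \<rightarrow>\<^sub>E (UNIV :: 'a set)"
  have "bij_betw (\<lambda>c. \<Sum>b\<in>B. scale (c b) b) ?F u"
  proof (rule bij_betwI')
    fix c d assume cd: "c \<in> ?F" "d \<in> ?F"
    show "((\<Sum>b\<in>B. scale (c b) b) = (\<Sum>b\<in>B. scale (d b) b)) = (c = d)"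
    proof
      assume eq: "(\<Sum>b\<in>B. scale (c b) b) = (\<Sum>b\<in>B. scale (d b) b)"
      have "(\<Sum>b\<in>B. scale (c b - d b) b) = 0"
        using eq by (simp add: scale_left_diff_distrib sum_subtractf)
      then have "\<forall>b\<in>B. c b - d b = 0"
        using B(2)[unfolded fin.independent_explicit] by (auto dest!: spec[of _ "\<lambda>b. c b - d b"])
      then have "\<And>b. b \<in> B \<Longrightarrow> c b = d b" by simp
      then show "c = d" using PiE_ext[OF cd] by blast
    qed simp
  next
    fix c assume "c \<in> ?F"
    show "(\<Sum>b\<in>B. scale (c b) b) \<in> u"
      using B(1) by (intro subspace_sum[OF assms] subspace_scale[OF assms]) auto
  next
    fix a assume "a \<in> u"
    then obtain c where "a = (\<Sum>b\<in>B. scale (c b) b)"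
      using spB span_finite[OF finB] by blast
    then show "\<exists>c\<in>?F. a = (\<Sum>b\<in>B. scale (c b) b)"
      by (intro bexI[of _ "restrict c B"]) auto
  qed
  then have "card ?F = card u" by (rule bij_betw_same_card)
  then show ?thesis using B(4) finB card_field by (simp add: card_PiE)
qed

lemma sum_spaceI: "subspace u \<Longrightarrow> subspace v \<Longrightarrow> u \<subseteq> sum_space u v"
  "subspace u \<Longrightarrow> subspace v \<Longrightarrow> v \<subseteq> sum_space u v"
  by (force simp: sum_space_def dest: subspace_0)+

lemma sum_space_least: "subspace w \<Longrightarrow> u \<subseteq> w \<Longrightarrow> v \<subseteq> w \<Longrightarrow> sum_space u v \<subseteq> w"
  by (auto simp: sum_space_def intro!: subspace_add)

lemma subspace_sum_space: "subspace u \<Longrightarrow> subspace v \<Longrightarrow> subspace (sum_space u v)"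
  unfolding sum_space_def by (rule subspace_sums)

lemma dim_sum_space: "subspace u \<Longrightarrow> subspace v \<Longrightarrow> dim (sum_space u v) + dim (u \<inter> v) = dim u + dim v"
  unfolding sum_space_def by (rule fin.dim_sums_Int)

text \<open>Every vector of \<open>t\<close> outside \<open>m\<close> generates together with \<open>m\<close> exactly one such \<open>w\<close>, so the sets
  \<open>w - m\<close>, all of the same size, partition \<open>t - m\<close>.\<close>

lemma card_points: assumes "subspace m" "subspace t" "m \<subseteq> t"
  shows "(real q - 1) * card {w. subspace w \<and> m \<subseteq> w \<and> w \<subseteq> t \<and> dim w = dim m + 1} = real q ^ (dim t - dim m) - 1"
proof -
  let ?W = "{w. subspace w \<and> m \<subseteq> w \<and> w \<subseteq> t \<and> dim w = dim m + 1}"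
  have le: "dim m \<le> dim t" by (rule fin.dim_subset[OF assms(3)])
  have un: "t - m = (\<Union>w\<in>?W. w - m)"
  proof
    show "(\<Union>w\<in>?W. w - m) \<subseteq> t - m" by blast
    show "t - m \<subseteq> (\<Union>w\<in>?W. w - m)"
    proof
      fix a assume a: "a \<in> t - m"
      have d: "dim (insert a m) = dim m + 1"
        using a by (simp add: fin.dim_insert span_eq_iff[THEN iffD2, OF assms(1)])
      have "span (insert a m) \<subseteq> t" using a assms by (intro span_minimal) auto
      then have "span (insert a m) \<in> ?W" using d by (auto intro: span_base)
      moreover have "a \<in> span (insert a m)" by (auto intro: span_base)
      ultimately show "a \<in> (\<Union>w\<in>?W. w - m)" using a by blast
    qed
  qed
  have disj: "(w - m) \<inter> (w' - m) = {}" if w: "w \<in> ?W" "w' \<in> ?W" "w \<noteq> w'" for w w'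
  proof (rule ccontr)
    assume "(w - m) \<inter> (w' - m) \<noteq> {}"
    then obtain a where a: "a \<in> w" "a \<in> w'" "a \<notin> m" by blast
    have d: "dim (insert a m) = dim m + 1" using a by (simp add: fin.dim_insert span_eq_iff[THEN iffD2, OF assms(1)])
    have *: "span (insert a m) = z" if "z \<in> ?W" "a \<in> z" for z
    proof (rule fin.subspace_dim_equal)
      show "span (insert a m) \<subseteq> z" using that by (intro span_minimal) auto
    qed (use that d in auto)
    from *[OF w(1) a(1)] *[OF w(2) a(2)] w(3) show False by simp
  qed
  have "card (t - m) = (\<Sum>w\<in>?W. card (w - m))"
    unfolding un by (rule card_UN_disjoint) (use disj in auto)
  then have "real (card (t - m)) = (\<Sum>w\<in>?W. real (card (w - m)))" by simp
  also have "\<dots> = (\<Sum>w\<in>?W. real q ^ (dim m + 1) - real q ^ dim m)"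
    by (rule sum.cong) (auto simp: card_Diff_subset card_mono of_nat_diff card_subspace assms)
  finally have "real q ^ dim t - real q ^ dim m = card ?W * (real q ^ dim m * (real q - 1))"
    using assms by (simp add: card_Diff_subset card_mono of_nat_diff card_subspace algebra_simps)
  moreover have "real q ^ dim t = real q ^ dim m * real q ^ (dim t - dim m)"
    using le by (simp flip: power_add)
  ultimately have "real q ^ dim m * ((real q - 1) * card ?W) = real q ^ dim m * (real q ^ (dim t - dim m) - 1)"
    by (simp add: algebra_simps)
  then show ?thesis using q_pos by simp
qed

text \<open>The dual count, obtained without dual spaces: count the pairs \<open>(z, a)\<close> with \<open>a \<in> u - z\<close> in two
  ways. The hyperplanes that contain both \<open>m\<close> and a given \<open>a \<in> u - m\<close> are those above
  \<open>span (insert a m)\<close>, whose number is known by induction on the codimension of \<open>m\<close>. The resulting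
  linear equation for the number of hyperplanes is degenerate in codimension one, where the only
  hyperplane is \<open>m\<close> itself.\<close>

lemma card_hyperplanes: assumes "subspace u" "subspace m" "m \<subseteq> u"
  shows "(real q - 1) * card {z. subspace z \<and> m \<subseteq> z \<and> z \<subseteq> u \<and> dim u = dim z + 1} = real q ^ (dim u - dim m) - 1"
  using assms(2-)
proof (induction "dim u - dim m" arbitrary: m rule: less_induct)
  case less
  let ?Z = "\<lambda>m. {z. subspace z \<and> m \<subseteq> z \<and> z \<subseteq> u \<and> dim u = dim z + 1}"
  have le: "dim m \<le> dim u" by (rule fin.dim_subset[OF less.prems(2)])
  consider "dim u - dim m = 0" | "dim u - dim m = 1" | "dim u - dim m \<ge> 2" by linarith
  then show ?case
  proof cases
    case 1
    have "?Z m = {}"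
    proof -
      have False if "m \<subseteq> z" "dim u = dim z + 1" for z
        using fin.dim_subset[OF that(1)] that(2) 1 by linarith
      then show ?thesis by blast
    qed
    then show ?thesis using 1 by simp
  next
    case 2
    have "?Z m = {m}"
    proof -
      have "z = m" if "z \<in> ?Z m" for z
        using fin.subspace_dim_equal[of m z] that 2 le less.prems by force
      then show ?thesis using 2 less.prems by auto
    qed
    then show ?thesis using 2 by simp
  next
    case 3
    define c where "c = dim u - dim m"
    have c: "2 \<le> c" "dim u = dim m + c" using 3 le by (auto simp: c_def)
    \<comment> \<open>the induction hypothesis at \<open>span (insert a m)\<close>, of codimension \<open>c - 1\<close>\<close>
    have through: "(real q - 1) * card {z \<in> ?Z m. a \<in> z} = real q ^ (c - 1) - 1"
      if a: "a \<in> u - m" for a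
    proof -
      let ?m = "span (insert a m)"
      have d: "dim (insert a m) = dim m + 1" using a by (simp add: fin.dim_insert span_eq_iff[THEN iffD2, OF less.prems(1)])
      have sub: "?m \<subseteq> u" using a less.prems assms(1) by (intro span_minimal) auto
      have "{z \<in> ?Z m. a \<in> z} = ?Z ?m"
        using span_minimal[of "insert a m"] span_superset[of "insert a m"] by blast
      then show ?thesis
        using less.hyps[of ?m] sub d c by simp
    qed
    define Z where "Z = ?Z m"
    define X where "X = (real q - 1) * card Z"
    have "(\<Sum>z\<in>Z. real (card (u - z))) = (\<Sum>z\<in>Z. \<Sum>a | a \<in> u \<and> a \<notin> z. 1)"
      by (simp add: set_diff_eq)
    also have "\<dots> = (\<Sum>a\<in>u. \<Sum>z | z \<in> Z \<and> a \<notin> z. 1)"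
      by (rule sum.swap_restrict) auto
    also have "\<dots> = (\<Sum>a\<in>u - m. \<Sum>z | z \<in> Z \<and> a \<notin> z. 1)"
    proof (rule sum.mono_neutral_right)
      have "{z. z \<in> Z \<and> a \<notin> z} = {}" if "a \<in> m" for a using that by (auto simp: Z_def)
      then show "\<forall>a\<in>u - (u - m). (\<Sum>z | z \<in> Z \<and> a \<notin> z. 1) = (0::real)"
        by simp
    qed auto
    also have "\<dots> = (\<Sum>a\<in>u - m. real (card Z) - real (card {z \<in> Z. a \<in> z}))"
    proof (rule sum.cong[OF refl])
      fix a
      have "{z. z \<in> Z \<and> a \<notin> z} = Z - {z \<in> Z. a \<in> z}" by blast
      moreover have "real (card (Z - {z \<in> Z. a \<in> z})) = real (card Z) - real (card {z \<in> Z. a \<in> z})"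
        by (subst card_Diff_subset) (auto intro!: of_nat_diff card_mono)
      ultimately show "(\<Sum>z | z \<in> Z \<and> a \<notin> z. 1) = real (card Z) - real (card {z \<in> Z. a \<in> z})"
        by simp
    qed
    finally have dc: "(\<Sum>z\<in>Z. real (card (u - z)))
      = (\<Sum>a\<in>u - m. real (card Z) - real (card {z \<in> Z. a \<in> z}))" .
    have "real (card (u - z)) = real q ^ dim u - real q ^ (dim u - 1)" if "z \<in> Z" for z
      using that assms(1) by (simp add: Z_def card_Diff_subset card_mono of_nat_diff card_subspace)
    then have l: "(\<Sum>z\<in>Z. real (card (u - z))) = card Z * (real q ^ dim u - real q ^ (dim u - 1))"
      by simp
    have "(real q - 1) * (\<Sum>a\<in>u - m. real (card Z) - real (card {z \<in> Z. a \<in> z}))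
      = (\<Sum>a\<in>u - m. X - (real q ^ (c - 1) - 1))"
      unfolding sum_distrib_left right_diff_distrib X_def Z_def using through by (intro sum.cong) auto
    also have "\<dots> = (real q ^ dim u - real q ^ dim m) * (X - (real q ^ (c - 1) - 1))"
      using less.prems assms(1) by (simp add: card_Diff_subset card_mono of_nat_diff card_subspace)
    finally have r: "(real q - 1) * (card Z * (real q ^ dim u - real q ^ (dim u - 1))) = \<dots>"
      using dc l by simp
    obtain e where e: "c = Suc e" "e \<ge> 1" using c(1) by (cases c) auto
    have "X * (real q ^ dim m * (real q * real q ^ e - real q ^ e)) = (real q ^ dim m * (real q * real q ^ e - 1)) * (X - (real q ^ e - 1))"
      using r unfolding c(2) e X_def by (simp add: power_add algebra_simps)
    then have "real q ^ dim m * ((real q ^ e - 1) * X) = real q ^ dim m * ((real q ^ e - 1) * (real q * real q ^ e - 1))"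
      by (simp add: algebra_simps)
    \<comment> \<open>the factor \<open>q^e - 1\<close> vanishes in codimension one, that is, for \<open>e = 0\<close>\<close>
    moreover have "real q ^ e > 1" using q_gt_1 e(2) by (simp add: one_less_power)
    ultimately have "X = real q * real q ^ e - 1" using q_pos by simp
    then show ?thesis unfolding X_def Z_def c_def[symmetric] e by simp
  qed
qed

section \<open>Intersections with the fixed subspace\<close>

text \<open>The (in)equalities for dimensions in the diamond \<open>u \<inter> v, u, v, u + v\<close> from which all cover
  relations in the diamond follow by linear arithmetic. They express the modular law, and that for
  \<open>a \<subseteq> b\<close> the codimension of \<open>a \<inter> y\<close> in \<open>b \<inter> y\<close> is at most that of \<open>a\<close> in \<open>b\<close>.\<close>

lemma lattice_dims:
  assumes "subspace u" "subspace v"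
  defines "s \<equiv> sum_space u v" and "m \<equiv> u \<inter> v"
  shows "dim s + dim m = dim u + dim v"
    and "dim (u \<inter> y) + dim (v \<inter> y) \<le> dim (s \<inter> y) + dim (m \<inter> y)"
    and "dim m \<le> dim u" "dim m \<le> dim v"
    and "dim (m \<inter> y) \<le> dim (u \<inter> y)" "dim (m \<inter> y) \<le> dim (v \<inter> y)"
    and "dim (u \<inter> y) + dim m \<le> dim (m \<inter> y) + dim u" "dim (v \<inter> y) + dim m \<le> dim (m \<inter> y) + dim v"
    and "dim (s \<inter> y) + dim u \<le> dim (u \<inter> y) + dim s" "dim (s \<inter> y) + dim v \<le> dim (v \<inter> y) + dim s"
    and "dim (u \<inter> y) \<le> dim (s \<inter> y)" "dim (v \<inter> y) \<le> dim (s \<inter> y)"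
    and "dim u \<le> dim s" "dim v \<le> dim s"
    and "u \<noteq> v \<Longrightarrow> dim u = dim v \<Longrightarrow> dim m < dim u"
proof -
  have s: "subspace s" and m: "subspace m"
    using assms by (auto simp: subspace_sum_space subspace_inter)
  have us: "u \<subseteq> s" and vs: "v \<subseteq> s" using sum_spaceI[OF assms(1,2)] by (auto simp: s_def)
  have mu: "m \<subseteq> u" and mv: "m \<subseteq> v" by (auto simp: m_def)
  have rel: "dim (b \<inter> y) + dim a \<le> dim (a \<inter> y) + dim b" if "subspace a" "subspace b" "a \<subseteq> b" for a b
  proof -
    have "dim (sum_space a (b \<inter> y)) + dim (a \<inter> (b \<inter> y)) = dim a + dim (b \<inter> y)"
      using that subspace_y by (intro dim_sum_space subspace_inter)
    moreover have "a \<inter> (b \<inter> y) = a \<inter> y" using that by blast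
    moreover have "dim (sum_space a (b \<inter> y)) \<le> dim b"
      using that by (intro fin.dim_subset sum_space_least) auto
    ultimately show ?thesis by simp
  qed
  show "dim s + dim m = dim u + dim v" unfolding s_def m_def by (rule dim_sum_space[OF assms(1,2)])
  have "dim (sum_space (u \<inter> y) (v \<inter> y)) + dim ((u \<inter> y) \<inter> (v \<inter> y)) = dim (u \<inter> y) + dim (v \<inter> y)"
    using assms subspace_y by (intro dim_sum_space subspace_inter)
  moreover have "sum_space (u \<inter> y) (v \<inter> y) \<subseteq> s \<inter> y"
    using s us vs subspace_y by (intro sum_space_least subspace_inter) auto
  then have "dim (sum_space (u \<inter> y) (v \<inter> y)) \<le> dim (s \<inter> y)" by (rule fin.dim_subset)
  moreover have "(u \<inter> y) \<inter> (v \<inter> y) = m \<inter> y" by (auto simp: m_def)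
  ultimately show "dim (u \<inter> y) + dim (v \<inter> y) \<le> dim (s \<inter> y) + dim (m \<inter> y)" by simp
  show "dim m \<le> dim u" "dim m \<le> dim v" "dim u \<le> dim s" "dim v \<le> dim s"
    "dim (m \<inter> y) \<le> dim (u \<inter> y)" "dim (m \<inter> y) \<le> dim (v \<inter> y)"
    "dim (u \<inter> y) \<le> dim (s \<inter> y)" "dim (v \<inter> y) \<le> dim (s \<inter> y)"
    using us vs mu mv by (auto intro!: fin.dim_subset)
  show "dim (u \<inter> y) + dim m \<le> dim (m \<inter> y) + dim u" "dim (v \<inter> y) + dim m \<le> dim (m \<inter> y) + dim v"
    "dim (s \<inter> y) + dim u \<le> dim (u \<inter> y) + dim s" "dim (s \<inter> y) + dim v \<le> dim (v \<inter> y) + dim s"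
    using rel s m us vs mu mv assms(1,2) by blast+
  assume ne: "u \<noteq> v" and eq: "dim u = dim v"
  show "dim m < dim u"
  proof (rule ccontr)
    assume "\<not> dim m < dim u"
    then have "m = u" "m = v"
      using fin.subspace_dim_equal[OF m assms(1) mu] fin.subspace_dim_equal[OF m assms(2) mv] eq by auto
    then show False using ne by simp
  qed
qed

lemma common_cover_eq_sum:
  assumes "covers w u" "covers w v" "u \<noteq> v"
  shows "w = sum_space u v"
proof -
  have sub: "subspace u" "subspace v" "subspace w" using assms by (auto simp: covers_def P_def)
  have "sum_space u v \<subseteq> w" using assms sub by (intro sum_space_least) (auto simp: covers_def)
  then show ?thesis
    using fin.subspace_dim_equal[of "sum_space u v" w] lattice_dims(1,15)[OF sub(1,2)] sub assms
    by (auto simp: covers_def subspace_sum_space)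
qed

lemma common_cocover_eq_inter:
  assumes "covers u z" "covers v z" "u \<noteq> v"
  shows "z = u \<inter> v"
proof -
  have sub: "subspace u" "subspace v" "subspace z" using assms by (auto simp: covers_def P_def)
  have "z \<subseteq> u \<inter> v" using assms by (auto simp: covers_def)
  then show ?thesis
    using fin.subspace_dim_equal[of z "u \<inter> v"] lattice_dims(15)[OF sub(1,2)] sub assms
    by (auto simp: covers_def subspace_inter)
qed

lemma covers_sum_inter_iff:
  assumes "u \<in> P" "v \<in> P"
  shows "covers (sum_space u v) u \<longleftrightarrow> dim (sum_space u v) = dim u + 1"
    "covers (sum_space u v) v \<longleftrightarrow> dim (sum_space u v) = dim v + 1"
    "covers u (u \<inter> v) \<longleftrightarrow> dim u = dim (u \<inter> v) + 1"
    "covers v (u \<inter> v) \<longleftrightarrow> dim v = dim (u \<inter> v) + 1"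
  using assms sum_spaceI[of u v] subspace_sum_space[of u v] subspace_inter[of u v]
  by (auto simp: covers_def P_def)

text \<open>This and the next two lemmas compare the ways to go up and then down with those to go down and
  then up. Here both routes exist under the same condition, whence \<open>L\<^sub>1 R\<^sub>2 = R\<^sub>2 L\<^sub>1\<close>.\<close>

lemma diamond_slash_backslash:
  assumes "u \<in> P" "v \<in> P"
  shows "slash_covers (sum_space u v) u \<and> backslash_covers (sum_space u v) v
    \<longleftrightarrow> backslash_covers u (u \<inter> v) \<and> slash_covers v (u \<inter> v)"
proof -
  have "subspace u" "subspace v" using assms by (auto simp: P_def)
  note d = lattice_dims[OF this]
  show ?thesis
    unfolding slash_covers_def backslash_covers_def covers_sum_inter_iff[OF assms]
    using d(1-14) by linarith
qed

text \<open>If \<open>u + v\<close> slash-covers \<open>u\<close> and \<open>v\<close>, then \<open>u \<inter> y\<close> and \<open>v \<inter> y\<close> may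
  coincide (the relation of \<open>F\<^sup>0\<close>) or differ (the relation of \<open>F\<^sup>-\<close>).\<close>

lemma diamond_slash_slash:
  assumes "u \<in> P" "v \<in> P" "u \<noteq> v"
  shows "slash_covers (sum_space u v) u \<and> slash_covers (sum_space u v) v \<longleftrightarrow>
    (slash_covers (sum_space u v) u \<and> slash_covers (sum_space u v) v \<and>
      backslash_covers u (u \<inter> v) \<and> backslash_covers v (u \<inter> v))
    \<or> (slash_covers u (u \<inter> v) \<and> slash_covers v (u \<inter> v))"
proof -
  have "subspace u" "subspace v" using assms by (auto simp: P_def)
  note d = lattice_dims[OF this]
  show ?thesis
    unfolding slash_covers_def backslash_covers_def covers_sum_inter_iff[OF assms(1,2)]
    using d(1-14) by linarith
qed

text \<open>If \<open>u\<close> and \<open>v\<close> backslash-cover \<open>u \<inter> v\<close>, all three have the same intersection with \<open>y\<close>, and \<open>u + v\<close> may have a larger one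
  (the relation of \<open>F\<^sup>0\<close>) or again the same one (the relation of \<open>F\<^sup>+\<close>).\<close>

lemma diamond_backslash_backslash:
  assumes "u \<in> P" "v \<in> P" "u \<noteq> v"
  shows "backslash_covers u (u \<inter> v) \<and> backslash_covers v (u \<inter> v) \<longleftrightarrow>
    (slash_covers (sum_space u v) u \<and> slash_covers (sum_space u v) v \<and>
      backslash_covers u (u \<inter> v) \<and> backslash_covers v (u \<inter> v))
    \<or> (backslash_covers (sum_space u v) u \<and> backslash_covers (sum_space u v) v)"
proof -
  have "subspace u" "subspace v" using assms by (auto simp: P_def)
  note d = lattice_dims[OF this]
  show ?thesis
    unfolding slash_covers_def backslash_covers_def covers_sum_inter_iff[OF assms(1,2)]
    using d(1-14) by linarith
qed

section \<open>Counting covers\<close>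

lemma covers_cases:
  assumes "covers w u"
  shows "slash_covers w u \<or> backslash_covers w u"
proof -
  have sub: "subspace u" "subspace w" and uw: "u \<inter> w = u" using assms by (auto simp: covers_def P_def)
  show ?thesis
    using lattice_dims(8,6)[OF sub, unfolded uw] assms
    by (auto simp: slash_covers_def backslash_covers_def covers_def)
qed

lemma not_slash_and_backslash: "\<not> (slash_covers w u \<and> backslash_covers w u)"
  by (auto simp: slash_covers_def backslash_covers_def)

text \<open>Slash-covers are the points of the interval from \<open>u\<close> to \<open>u + y\<close>, so \<open>card_points\<close> counts them.\<close>

lemma slash_covers_iff_le_sum:
  assumes "u \<in> P"
  shows "slash_covers w u \<longleftrightarrow> subspace w \<and> u \<subseteq> w \<and> w \<subseteq> sum_space u y \<and> dim w = dim u + 1"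
proof
  assume s: "slash_covers w u"
  then have c: "covers w u" by (simp add: slash_covers_def)
  have sub: "subspace u" "subspace w" "u \<subseteq> w" "dim w = dim u + 1" using c by (auto simp: covers_def P_def)
  have wy: "subspace (w \<inter> y)" using sub subspace_y by (simp add: subspace_inter)
  have "dim (sum_space u (w \<inter> y)) + dim (u \<inter> (w \<inter> y)) = dim u + dim (w \<inter> y)"
    by (rule dim_sum_space[OF sub(1) wy])
  moreover have "u \<inter> (w \<inter> y) = u \<inter> y" using sub by blast
  ultimately have "dim (sum_space u (w \<inter> y)) = dim w"
    using s c by (simp add: slash_covers_def covers_def)
  moreover have "sum_space u (w \<inter> y) \<subseteq> w" using sub by (intro sum_space_least) auto
  ultimately have "sum_space u (w \<inter> y) = w"
    using fin.subspace_dim_equal[OF subspace_sum_space[OF sub(1) wy] sub(2)] by simp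
  moreover have "sum_space u (w \<inter> y) \<subseteq> sum_space u y" by (auto simp: sum_space_def)
  ultimately show "subspace w \<and> u \<subseteq> w \<and> w \<subseteq> sum_space u y \<and> dim w = dim u + 1" using sub by simp
next
  assume w: "subspace w \<and> u \<subseteq> w \<and> w \<subseteq> sum_space u y \<and> dim w = dim u + 1"
  then have c: "covers w u" using assms by (simp add: covers_def P_def)
  have "u \<noteq> w" using w by auto
  then obtain a where a: "a \<in> w" "a \<notin> u" using w by blast
  then obtain b c where bc: "b \<in> u" "c \<in> y" "a = b + c" using w by (auto simp: sum_space_def)
  \<comment> \<open>\<open>c\<close> is a vector of \<open>w \<inter> y\<close> outside \<open>u\<close>, so the intersection with \<open>y\<close> grows\<close>
  have "c \<notin> u" using a bc assms by (auto simp: P_def subspace_add)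
  moreover have "a - b \<in> w" using a bc w by (intro subspace_diff) auto
  then have "c \<in> w \<inter> y" using bc by simp
  ultimately have ne: "u \<inter> y \<noteq> w \<inter> y" by blast
  have "dim (u \<inter> y) \<noteq> dim (w \<inter> y)"
  proof
    assume eq: "dim (u \<inter> y) = dim (w \<inter> y)"
    have "u \<inter> y = w \<inter> y"
      by (rule fin.subspace_dim_equal) (use w assms subspace_y eq in \<open>auto simp: P_def subspace_inter\<close>)
    then show False using ne by simp
  qed
  then show "slash_covers w u" using covers_cases[OF c] by (auto simp: backslash_covers_def)
qed

text \<open>Dually, the subspaces that \<open>u\<close> backslash-covers are the hyperplanes of the interval from \<open>u \<inter> y\<close>
  to \<open>u\<close>.\<close>

lemma backslash_covers_iff_ge_inter:
  assumes "u \<in> P"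
  shows "backslash_covers u z \<longleftrightarrow> subspace z \<and> u \<inter> y \<subseteq> z \<and> z \<subseteq> u \<and> dim u = dim z + 1"
proof
  assume b: "backslash_covers u z"
  then have "z \<inter> y = u \<inter> y"
    using subspace_y
    by (intro fin.subspace_dim_equal) (auto simp: backslash_covers_def covers_def P_def subspace_inter)
  then show "subspace z \<and> u \<inter> y \<subseteq> z \<and> z \<subseteq> u \<and> dim u = dim z + 1"
    using b by (auto simp: backslash_covers_def covers_def P_def)
next
  assume z: "subspace z \<and> u \<inter> y \<subseteq> z \<and> z \<subseteq> u \<and> dim u = dim z + 1"
  then have "z \<inter> y = u \<inter> y" by blast
  then show "backslash_covers u z"
    using z assms by (simp add: backslash_covers_def covers_def P_def)
qed

lemma dim_eq_idx: "dim u = idx_i u + idx_j u"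
  by (simp add: idx_i_def idx_j_def fin.dim_subset)

lemma idx_i_le_k: "idx_i u \<le> k"
  unfolding idx_i_def dim_y[symmetric] by (rule fin.dim_subset) simp

lemma dim_le: "dim u \<le> h + k"
  unfolding dim_space[symmetric] by (rule fin.dim_subset) simp

lemma q_ne_0: "real q \<noteq> 0"
  using q_pos by simp

text \<open>The four cover counts are multiplied by \<open>q - 1\<close> and written with quotients of powers, which avoids
  truncated subtraction in the exponents.\<close>

lemma card_slash_above:
  assumes "u \<in> P"
  shows "(real q - 1) * card {w. slash_covers w u} = real q ^ k / real q ^ idx_i u - 1"
proof -
  have u: "subspace u" using assms by (simp add: P_def)
  have "dim (sum_space u y) - dim u = k - idx_i u"
    using dim_sum_space[OF u subspace_y] dim_y idx_i_le_k[of u] by (simp add: idx_i_def)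
  moreover have "real q ^ (k - idx_i u) = real q ^ k / real q ^ idx_i u"
    using q_ne_0 idx_i_le_k[of u] by (simp add: power_diff)
  ultimately show ?thesis
    using card_points[OF u subspace_sum_space[OF u subspace_y] sum_spaceI(1)[OF u subspace_y]]
    by (simp add: slash_covers_iff_le_sum[OF assms])
qed

lemma card_backslash_below:
  assumes "u \<in> P"
  shows "(real q - 1) * card {z. backslash_covers u z} = real q ^ idx_j u - 1"
proof -
  have u: "subspace u" using assms by (simp add: P_def)
  show ?thesis
    using card_hyperplanes[OF u subspace_inter[OF u subspace_y]]
    by (simp add: backslash_covers_iff_ge_inter[OF assms] idx_j_def)
qed

lemma card_backslash_above:
  assumes "u \<in> P"
  shows "(real q - 1) * card {w. backslash_covers w u}
    = real q ^ (h + k) / (real q ^ idx_i u * real q ^ idx_j u) - real q ^ k / real q ^ idx_i u"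
proof -
  have u: "subspace u" using assms by (simp add: P_def)
  let ?C = "{w. subspace w \<and> u \<subseteq> w \<and> w \<subseteq> UNIV \<and> dim w = dim u + 1}"
  have split: "?C = {w. slash_covers w u} \<union> {w. backslash_covers w u}"
  proof (intro set_eqI iffI)
    fix w assume "w \<in> ?C"
    then have "covers w u" using assms by (simp add: covers_def P_def)
    then show "w \<in> {w. slash_covers w u} \<union> {w. backslash_covers w u}"
      using covers_cases by blast
  next
    fix w assume "w \<in> {w. slash_covers w u} \<union> {w. backslash_covers w u}"
    then have "covers w u" by (auto simp: slash_covers_def backslash_covers_def)
    then show "w \<in> ?C" by (simp add: covers_def P_def)
  qed
  have "card ?C = card {w. slash_covers w u} + card {w. backslash_covers w u}"
    unfolding split by (rule card_Un_disjoint) (use not_slash_and_backslash in auto)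
  then have "(real q - 1) * card {w. backslash_covers w u}
    = (real q - 1) * card ?C - (real q - 1) * card {w. slash_covers w u}"
    by (simp add: algebra_simps)
  also have "(real q - 1) * card ?C = real q ^ (h + k - dim u) - 1"
    using card_points[OF u subspace_UNIV subset_UNIV] by (simp only: dim_space)
  also have "real q ^ (h + k - dim u) = real q ^ (h + k) / (real q ^ idx_i u * real q ^ idx_j u)"
    using q_ne_0 dim_le[of u] by (simp add: power_diff dim_eq_idx[of u] power_add)
  finally show ?thesis using card_slash_above[OF assms] by simp
qed

lemma card_slash_below:
  assumes "u \<in> P"
  shows "(real q - 1) * card {z. slash_covers u z} = real q ^ idx_i u * real q ^ idx_j u - real q ^ idx_j u"
proof -
  have u: "subspace u" using assms by (simp add: P_def)
  let ?C = "{z. subspace z \<and> {0} \<subseteq> z \<and> z \<subseteq> u \<and> dim u = dim z + 1}"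
  have split: "?C = {z. slash_covers u z} \<union> {z. backslash_covers u z}"
  proof (intro set_eqI iffI)
    fix z assume "z \<in> ?C"
    then have "covers u z" using assms by (simp add: covers_def P_def)
    then show "z \<in> {z. slash_covers u z} \<union> {z. backslash_covers u z}"
      using covers_cases by blast
  next
    fix z assume "z \<in> {z. slash_covers u z} \<union> {z. backslash_covers u z}"
    then have "covers u z" by (auto simp: slash_covers_def backslash_covers_def)
    then show "z \<in> ?C" by (simp add: covers_def P_def subspace_0)
  qed
  have "card ?C = card {z. slash_covers u z} + card {z. backslash_covers u z}"
    unfolding split by (rule card_Un_disjoint) (use not_slash_and_backslash in auto)
  then have "(real q - 1) * card {z. slash_covers u z}
    = (real q - 1) * card ?C - (real q - 1) * card {z. backslash_covers u z}"
    by (simp add: algebra_simps)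
  also have "(real q - 1) * card ?C = real q ^ dim u - 1"
    using card_hyperplanes[OF u subspace_single_0] subspace_0[OF u] by simp
  finally show ?thesis using card_backslash_below[OF assms] by (simp add: dim_eq_idx[of u] power_add)
qed

text \<open>Suppose that \<open>v\<close> is two dimensions above \<open>u\<close>, and its intersection with \<open>y\<close> one dimension above.
  Of the \<open>q + 1\<close> subspaces in between, only \<open>u + (v \<inter> y)\<close> slash-covers \<open>u\<close>; the other \<open>q\<close> backslash-cover
  it.\<close>

lemma card_between:
  assumes "u \<in> P" "v \<in> P"
  shows "card {w. backslash_covers w u \<and> slash_covers v w} = q * card {w. slash_covers w u \<and> backslash_covers v w}"
    (is "card ?T = q * card ?S")
proof (cases "u \<subseteq> v \<and> dim v = dim u + 2 \<and> dim (v \<inter> y) = dim (u \<inter> y) + 1")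
  case False
  have "\<not> (backslash_covers w u \<and> slash_covers v w)" "\<not> (slash_covers w u \<and> backslash_covers v w)" for w
  proof -
    have "u \<subseteq> v \<and> dim v = dim u + 2 \<and> dim (v \<inter> y) = dim (u \<inter> y) + 1"
      if c: "covers w u" "covers v w" and d: "dim (v \<inter> y) = dim (u \<inter> y) + 1"
      using c d unfolding covers_def by (intro conjI) (blast, linarith, blast)
    then show "\<not> (backslash_covers w u \<and> slash_covers v w)" "\<not> (slash_covers w u \<and> backslash_covers v w)"
      using False unfolding slash_covers_def backslash_covers_def by auto
  qed
  then have "?T = {}" "?S = {}" by blast+
  then show ?thesis by (simp only: card.empty)
next
  case True
  have u: "subspace u" and v: "subspace v" using assms by (auto simp: P_def)
  let ?I = "{w. subspace w \<and> u \<subseteq> w \<and> w \<subseteq> v \<and> dim w = dim u + 1}"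
  have "(real q - 1) * card ?I = (real q - 1) * (real q + 1)"
  proof -
    have "dim v - dim u = 2" using True by simp
    then have "(real q - 1) * card ?I = real q ^ 2 - 1" using card_points[OF u v] True by simp
    also have "\<dots> = (real q - 1) * (real q + 1)" by (simp add: power2_eq_square algebra_simps)
    finally show ?thesis .
  qed
  then have cI: "real (card ?I) = real (q + 1)" using q_gt_1 by simp
  have I: "?I = {w. covers w u \<and> covers v w}"
  proof (intro Collect_cong)
    fix w
    have "dim v = dim u + 2" using True by blast
    then have "dim v = dim w + 1 \<longleftrightarrow> dim w = dim u + 1" by linarith
    then show "subspace w \<and> u \<subseteq> w \<and> w \<subseteq> v \<and> dim w = dim u + 1 \<longleftrightarrow> covers w u \<and> covers v w"
      unfolding covers_def using assms by (auto simp: P_def)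
  qed
  \<comment> \<open>along \<open>u < w < v\<close> the intersection with \<open>y\<close> grows exactly once: at the first or the second step\<close>
  have split: "?I = ?S \<union> ?T" unfolding I
  proof (intro set_eqI iffI)
    fix w assume "w \<in> {w. covers w u \<and> covers v w}"
    then have c: "covers w u" "covers v w" by blast+
    have "dim (v \<inter> y) = dim (u \<inter> y) + 1" using True by blast
    then have "dim (w \<inter> y) = dim (u \<inter> y) + 1 \<and> dim (v \<inter> y) = dim (w \<inter> y)
      \<or> dim (w \<inter> y) = dim (u \<inter> y) \<and> dim (v \<inter> y) = dim (w \<inter> y) + 1"
      using covers_cases[OF c(1)] covers_cases[OF c(2)]
      unfolding slash_covers_def backslash_covers_def by arith
    then show "w \<in> ?S \<union> ?T"
      using c unfolding slash_covers_def backslash_covers_def by blast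
  qed (auto simp: slash_covers_def backslash_covers_def)
  have "card ?I = card ?S + card ?T"
    unfolding split by (rule card_Un_disjoint) (use not_slash_and_backslash in auto)
  moreover have "?S = {sum_space u (v \<inter> y)}"
  proof -
    let ?w = "sum_space u (v \<inter> y)"
    have vy: "subspace (v \<inter> y)" using v subspace_y by (simp add: subspace_inter)
    have w: "subspace ?w" by (rule subspace_sum_space[OF u vy])
    have le: "u \<subseteq> ?w" "v \<inter> y \<subseteq> ?w" by (rule sum_spaceI[OF u vy])+
    have wv: "?w \<subseteq> v" using v True by (intro sum_space_least) auto
    have "u \<inter> (v \<inter> y) = u \<inter> y" using True by blast
    then have dw: "dim ?w = dim u + 1" using dim_sum_space[OF u vy] True by simp
    have "?w \<inter> y = v \<inter> y" using le wv by blast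
    then have "?w \<in> ?S"
      using True dw w le wv assms by (auto simp: slash_covers_def backslash_covers_def covers_def P_def)
    moreover have "z = ?w" if z: "z \<in> ?S" for z
    proof -
      have zs: "subspace z" "z \<in> P" "u \<subseteq> z" "dim z = dim u + 1"
        using z by (auto simp: slash_covers_def covers_def P_def)
      have "v \<inter> y \<subseteq> z" using z backslash_covers_iff_ge_inter[OF assms(2), of z] by simp
      then have "?w \<subseteq> z" using zs by (intro sum_space_least) auto
      then show ?thesis using fin.subspace_dim_equal[OF w zs(1)] dw zs by simp
    qed
    ultimately show ?thesis by blast
  qed
  ultimately show ?thesis using cI by simp
qed

end

section \<open>Products of the raising and lowering matrices\<close>

lemma matrix_mult_scaleR [simp]:
  fixes A :: "complex^'n::finite^'m::finite" and B :: "complex^'p::finite^'n"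
  shows "(c *\<^sub>R A) ** B = c *\<^sub>R (A ** B)" "A ** (c *\<^sub>R B) = c *\<^sub>R (A ** B)"
  by (simp_all add: matrix_matrix_mult_def vec_eq_iff scaleR_sum_right)

lemma matrix_mult_distribs:
  fixes A B :: "complex^'n::finite^'m::finite" and C D :: "complex^'p::finite^'n"
  shows "(A + B) ** C = A ** C + B ** C" "(A - B) ** C = A ** C - B ** C"
    "A ** (C + D) = A ** C + A ** D" "A ** (C - D) = A ** C - A ** D"
  by (simp_all add: matrix_matrix_mult_def vec_eq_iff algebra_simps sum.distrib sum_subtractf)

lemma matrix_mult_sum_distrib:
  fixes B :: "complex^'n::finite^'n" and f :: "'i \<Rightarrow> complex^'n^'n"
  shows "B ** (\<Sum>l\<in>I. f l) = (\<Sum>l\<in>I. B ** f l)" "(\<Sum>l\<in>I. f l) ** B = (\<Sum>l\<in>I. f l ** B)"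
proof -
  have 0: "B ** (0 :: complex^'n^'n) = 0" "(0 :: complex^'n^'n) ** B = 0"
    by (simp_all add: vec_eq_iff matrix_matrix_mult_def)
  show "B ** (\<Sum>l\<in>I. f l) = (\<Sum>l\<in>I. B ** f l)"
    by (induction I rule: infinite_finite_induct) (simp_all add: 0 matrix_mult_distribs)
  show "(\<Sum>l\<in>I. f l) ** B = (\<Sum>l\<in>I. f l ** B)"
    by (induction I rule: infinite_finite_induct) (simp_all add: 0 matrix_mult_distribs)
qed

context subspace_lattice begin

lemma rel_mat_mult:
  "(rel_mat r ** rel_mat s) $ u $ v
    = (if u \<in> P \<and> v \<in> P then of_nat (card {w \<in> P. r u w \<and> s w v}) else 0)"
proof -
  have "(rel_mat r ** rel_mat s) $ u $ v
    = (\<Sum>w\<in>UNIV. if u \<in> P \<and> v \<in> P \<and> w \<in> P \<and> r u w \<and> s w v then 1 else 0)"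
    unfolding matrix_matrix_mult_def rel_mat_def by (auto intro!: sum.cong)
  also have "\<dots> = of_nat (card {w. u \<in> P \<and> v \<in> P \<and> w \<in> P \<and> r u w \<and> s w v})"
    by (simp add: sum.If_cases)
  finally show ?thesis by (cases "u \<in> P \<and> v \<in> P") auto
qed

lemma diag_mult_entry:
  "(diag_P f ** A) $ u $ v = (if u \<in> P then of_real (f u) * A $ u $ v else 0)"
  "(A ** diag_P f) $ u $ v = (if v \<in> P then A $ u $ v * of_real (f v) else 0)"
proof -
  have "(if u \<in> P \<and> u = w then complex_of_real (f u) else 0) * A $ w $ v
      = (if u = w then if u \<in> P then of_real (f u) * A $ u $ v else 0 else 0)" for w
    by simp
  then show "(diag_P f ** A) $ u $ v = (if u \<in> P then of_real (f u) * A $ u $ v else 0)"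
    by (simp add: matrix_matrix_mult_def diag_P_def)
  have "A $ u $ w * (if w \<in> P \<and> w = v then complex_of_real (f w) else 0)
      = (if w = v then if v \<in> P then A $ u $ v * of_real (f v) else 0 else 0)" for w
    by simp
  then show "(A ** diag_P f) $ u $ v = (if v \<in> P then A $ u $ v * of_real (f v) else 0)"
    by (simp add: matrix_matrix_mult_def diag_P_def)
qed

text \<open>The entries depend on the type only. All diagonal matrices of the argument have this form, and
  moving one of them past \<open>L\<^sub>1\<close> or \<open>L\<^sub>2\<close> shifts one of the two arguments.\<close>

definition tdiag :: "(nat \<Rightarrow> nat \<Rightarrow> real) \<Rightarrow> complex^'v set^'v set"
  where "tdiag \<phi> = diag_P (\<lambda>u. \<phi> (idx_i u) (idx_j u))"

lemma tdiag_entry: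
  "tdiag \<phi> $ u $ v = (if u \<in> P \<and> u = v then of_real (\<phi> (idx_i u) (idx_j u)) else 0)"
  by (simp add: tdiag_def diag_P_def)

lemma slash_covers_idx: "slash_covers v u \<Longrightarrow> idx_i v = Suc (idx_i u) \<and> idx_j v = idx_j u"
  using dim_eq_idx[of u] dim_eq_idx[of v] by (auto simp: slash_covers_def covers_def idx_i_def)

lemma backslash_covers_idx: "backslash_covers v u \<Longrightarrow> idx_i v = idx_i u \<and> idx_j v = Suc (idx_j u)"
  using dim_eq_idx[of u] dim_eq_idx[of v] by (auto simp: backslash_covers_def covers_def idx_i_def)

lemma tdiag_L1:
  assumes "\<And>i j. \<phi> i j = \<psi> (Suc i) j"
  shows "tdiag \<phi> ** L1 = L1 ** tdiag \<psi>"
  by (simp add: vec_eq_iff tdiag_def diag_mult_entry)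
    (auto simp: L1_def rel_mat_def assms dest: slash_covers_idx)

lemma tdiag_L2:
  assumes "\<And>i j. \<phi> i j = \<psi> i (Suc j)"
  shows "tdiag \<phi> ** L2 = L2 ** tdiag \<psi>"
  by (simp add: vec_eq_iff tdiag_def diag_mult_entry)
    (auto simp: L2_def rel_mat_def assms dest: backslash_covers_idx)

lemma R1_rel: "R1 = rel_mat (\<lambda>u v. slash_covers u v)"
  by (auto simp: R1_def L1_def rel_mat_def transpose_def vec_eq_iff)

lemma R2_rel: "R2 = rel_mat (\<lambda>u v. backslash_covers u v)"
  by (auto simp: R2_def L2_def rel_mat_def transpose_def vec_eq_iff)

lemma coversD: "slash_covers w u \<Longrightarrow> covers w u" "backslash_covers w u \<Longrightarrow> covers w u"
  by (auto simp: slash_covers_def backslash_covers_def)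

lemma covers_P: "covers w u \<Longrightarrow> w \<in> P \<and> u \<in> P"
  by (simp add: covers_def)

lemma card_common_cover:
  assumes "u \<noteq> v" "\<And>w. r w \<Longrightarrow> covers w u \<and> covers w v"
  shows "card {w \<in> P. r w} = (if r (sum_space u v) then 1 else 0)"
proof -
  have "{w \<in> P. r w} = (if r (sum_space u v) then {sum_space u v} else {})"
    using common_cover_eq_sum[OF _ _ assms(1)] assms(2) covers_P by (auto; blast)
  then show ?thesis by simp
qed

lemma card_common_cocover:
  assumes "u \<noteq> v" "\<And>w. r w \<Longrightarrow> covers u w \<and> covers v w"
  shows "card {w \<in> P. r w} = (if r (u \<inter> v) then 1 else 0)"
proof -
  have "{w \<in> P. r w} = (if r (u \<inter> v) then {u \<inter> v} else {})"
    using common_cocover_eq_inter[OF _ _ assms(1)] assms(2) covers_P by (auto; blast)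
  then show ?thesis by simp
qed

lemma sum_space_self: "u \<in> P \<Longrightarrow> sum_space u u = u"
  using sum_spaceI(1)[of u u] sum_space_least[of u u u] by (auto simp: P_def)

lemma not_slash_self: "\<not> slash_covers u u" "\<not> backslash_covers u u"
  by (simp_all add: slash_covers_def backslash_covers_def covers_def)

lemma L2_L1: "L2 ** L1 = real q *\<^sub>R (L1 ** L2)"
proof -
  have *: "{w \<in> P. backslash_covers w u \<and> slash_covers v w} = {w. backslash_covers w u \<and> slash_covers v w}"
    "{w \<in> P. slash_covers w u \<and> backslash_covers v w} = {w. slash_covers w u \<and> backslash_covers v w}" for u v
    using coversD covers_P by blast+
  show ?thesis
    unfolding L1_def L2_def by (simp add: vec_eq_iff rel_mat_mult * card_between scaleR_conv_of_real[where 'a=complex])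
qed

lemma L1_R2: "L1 ** R2 = R2 ** L1"
proof -
  have "card {w \<in> P. slash_covers w u \<and> backslash_covers w v}
      = card {w \<in> P. backslash_covers u w \<and> slash_covers v w}" if "u \<in> P" "v \<in> P" for u v
  proof (cases "u = v")
    case True
    then have "{w \<in> P. slash_covers w u \<and> backslash_covers w v} = {}"
      "{w \<in> P. backslash_covers u w \<and> slash_covers v w} = {}"
      using not_slash_and_backslash by auto
    then show ?thesis by (simp only: card.empty)
  next
    case False
    have "card {w \<in> P. slash_covers w u \<and> backslash_covers w v}
      = (if slash_covers (sum_space u v) u \<and> backslash_covers (sum_space u v) v then 1 else 0)"
      by (rule card_common_cover[OF False]) (use coversD in blast)
    moreover have "card {w \<in> P. backslash_covers u w \<and> slash_covers v w}
      = (if backslash_covers u (u \<inter> v) \<and> slash_covers v (u \<inter> v) then 1 else 0)"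
      by (rule card_common_cocover[OF False]) (use coversD in blast)
    ultimately show ?thesis using diamond_slash_backslash[OF that] by presburger
  qed
  then show ?thesis
    unfolding L1_def R2_rel by (simp add: vec_eq_iff rel_mat_mult)
qed

lemma R1_L2: "R1 ** L2 = L2 ** R1"
  using arg_cong[OF L1_R2, of transpose] by (simp add: R1_def R2_def matrix_transpose_mul)

lemma rel_mat_entry: "rel_mat r $ u $ v = (if u \<in> P \<and> v \<in> P \<and> r u v then 1 else 0)"
  by (simp add: rel_mat_def)

text \<open>The common pattern of the next four products: distinct \<open>u, v\<close> have at most one common cover, namely
  \<open>u + v\<close>, and at most one common cocover, \<open>u \<inter> v\<close>. So off the diagonal the product is a
  zero-one matrix, and the diagonal entries are the cover counts.\<close>

lemma rel_mat_mult_eq: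
  assumes diag: "\<And>u. u \<in> P \<Longrightarrow> (real q - 1) * card {w. r u w \<and> s w u} = \<phi> (idx_i u) (idx_j u)"
    and off: "\<And>u v. u \<in> P \<Longrightarrow> v \<in> P \<Longrightarrow> u \<noteq> v \<Longrightarrow>
      card {w \<in> P. r u w \<and> s w v} = (if t u v then 1 else 0)"
    and irrefl: "\<And>u. u \<in> P \<Longrightarrow> \<not> t u u"
    and P: "\<And>u w. r u w \<Longrightarrow> w \<in> P"
  shows "(real q - 1) *\<^sub>R (rel_mat r ** rel_mat s) = tdiag \<phi> + (real q - 1) *\<^sub>R rel_mat t"
proof -
  have "((real q - 1) *\<^sub>R (rel_mat r ** rel_mat s)) $ u $ v
    = (tdiag \<phi> + (real q - 1) *\<^sub>R rel_mat t) $ u $ v" for u v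
  proof (cases "u \<in> P \<and> v \<in> P")
    case False
    then show ?thesis by (auto simp: rel_mat_mult tdiag_entry rel_mat_entry)
  next
    case uv: True
    show ?thesis
    proof (cases "u = v")
      case True
      have "{w \<in> P. r u w \<and> s w u} = {w. r u w \<and> s w u}" using P by blast
      then have "((real q - 1) *\<^sub>R (rel_mat r ** rel_mat s)) $ u $ v
        = of_real ((real q - 1) * card {w. r u w \<and> s w u})"
        using True uv by (simp add: rel_mat_mult scaleR_conv_of_real[where 'a=complex])
      then show ?thesis
        using True uv irrefl[of u] unfolding diag[OF conjunct1[OF uv]]
        by (simp add: tdiag_entry rel_mat_entry)
    next
      case False
      then show ?thesis using uv off[of u v] by (simp add: rel_mat_mult tdiag_entry rel_mat_entry)
    qed
  qed
  then show ?thesis by (simp add: vec_eq_iff)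
qed

lemma F_zero_plus_F_minus:
  "F_zero + F_minus = rel_mat (\<lambda>u v. slash_covers (sum_space u v) u \<and> slash_covers (sum_space u v) v)"
proof -
  have "(F_zero + F_minus) $ u $ v
    = rel_mat (\<lambda>u v. slash_covers (sum_space u v) u \<and> slash_covers (sum_space u v) v) $ u $ v" for u v
  proof (cases "u \<in> P \<and> v \<in> P \<and> u \<noteq> v")
    case True
    then show ?thesis
      using diamond_slash_slash[of u v] not_slash_and_backslash[of u "u \<inter> v"]
      by (auto simp: F_zero_def F_minus_def rel_mat_entry)
  next
    case False
    then show ?thesis
      by (auto simp: F_zero_def F_minus_def rel_mat_entry sum_space_self not_slash_self)
  qed
  then show ?thesis by (simp add: vec_eq_iff)
qed

lemma F_zero_plus_F_plus:
  "F_zero + F_plus = rel_mat (\<lambda>u v. backslash_covers u (u \<inter> v) \<and> backslash_covers v (u \<inter> v))"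
proof -
  have "(F_zero + F_plus) $ u $ v
    = rel_mat (\<lambda>u v. backslash_covers u (u \<inter> v) \<and> backslash_covers v (u \<inter> v)) $ u $ v" for u v
  proof (cases "u \<in> P \<and> v \<in> P \<and> u \<noteq> v")
    case True
    then show ?thesis
      using diamond_backslash_backslash[of u v] not_slash_and_backslash[of "sum_space u v" u]
      by (auto simp: F_zero_def F_plus_def rel_mat_entry)
  next
    case False
    then show ?thesis
      by (auto simp: F_zero_def F_plus_def rel_mat_entry sum_space_self not_slash_self)
  qed
  then show ?thesis by (simp add: vec_eq_iff)
qed

lemma L1_R1: "(real q - 1) *\<^sub>R (L1 ** R1)
  = tdiag (\<lambda>i j. real q ^ k / real q ^ i - 1) + (real q - 1) *\<^sub>R (F_zero + F_minus)"
  unfolding L1_def R1_rel F_zero_plus_F_minus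
proof (rule rel_mat_mult_eq)
  show "card {w \<in> P. slash_covers w u \<and> slash_covers w v}
    = (if slash_covers (sum_space u v) u \<and> slash_covers (sum_space u v) v then 1 else 0)"
    if "u \<noteq> v" for u v
    by (rule card_common_cover[OF that]) (use coversD in blast)
qed (auto simp: card_slash_above sum_space_self not_slash_self dest!: coversD dest: covers_P)

lemma R1_L1: "(real q - 1) *\<^sub>R (R1 ** L1)
  = tdiag (\<lambda>i j. real q ^ i * real q ^ j - real q ^ j) + (real q - 1) *\<^sub>R F_minus"
  unfolding L1_def R1_rel F_minus_def
proof (rule rel_mat_mult_eq)
  show "card {w \<in> P. slash_covers u w \<and> slash_covers v w}
    = (if slash_covers u (u \<inter> v) \<and> slash_covers v (u \<inter> v) then 1 else 0)"
    if "u \<noteq> v" for u v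
    by (rule card_common_cocover[OF that]) (use coversD in blast)
qed (auto simp: card_slash_below not_slash_self dest!: coversD dest: covers_P)

lemma L2_R2: "(real q - 1) *\<^sub>R (L2 ** R2)
  = tdiag (\<lambda>i j. real q ^ (h + k) / (real q ^ i * real q ^ j) - real q ^ k / real q ^ i)
    + (real q - 1) *\<^sub>R F_plus"
  unfolding L2_def R2_rel F_plus_def
proof (rule rel_mat_mult_eq)
  show "card {w \<in> P. backslash_covers w u \<and> backslash_covers w v}
    = (if backslash_covers (sum_space u v) u \<and> backslash_covers (sum_space u v) v then 1 else 0)"
    if "u \<noteq> v" for u v
    by (rule card_common_cover[OF that]) (use coversD in blast)
qed (auto simp: card_backslash_above sum_space_self not_slash_self dest!: coversD dest: covers_P)

lemma R2_L2: "(real q - 1) *\<^sub>R (R2 ** L2)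
  = tdiag (\<lambda>i j. real q ^ j - 1) + (real q - 1) *\<^sub>R (F_zero + F_plus)"
  unfolding L2_def R2_rel F_zero_plus_F_plus
proof (rule rel_mat_mult_eq)
  show "card {w \<in> P. backslash_covers u w \<and> backslash_covers v w}
    = (if backslash_covers u (u \<inter> v) \<and> backslash_covers v (u \<inter> v) then 1 else 0)"
    if "u \<noteq> v" for u v
    by (rule card_common_cocover[OF that]) (use coversD in blast)
qed (auto simp: card_backslash_below not_slash_self dest!: coversD dest: covers_P)

section \<open>Elements that commute with the lowering matrices up to powers of q\<close>

lemma tdiag_simps:
  "tdiag \<phi> + tdiag \<psi> = tdiag (\<lambda>i j. \<phi> i j + \<psi> i j)"
  "tdiag \<phi> - tdiag \<psi> = tdiag (\<lambda>i j. \<phi> i j - \<psi> i j)"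
  "c *\<^sub>R tdiag \<phi> = tdiag (\<lambda>i j. c * \<phi> i j)"
  by (auto simp: vec_eq_iff tdiag_entry scaleR_conv_of_real[where 'a=complex])

lemma tdiag_mult: "tdiag \<phi> ** tdiag \<psi> = tdiag (\<lambda>i j. \<phi> i j * \<psi> i j)"
  by (simp add: tdiag_def diag_P_mult)

lemma tdiag_L1_scale:
  assumes "\<And>i j. \<phi> i j = c * \<phi> (Suc i) j"
  shows "tdiag \<phi> ** L1 = c *\<^sub>R (L1 ** tdiag \<phi>)"
  using tdiag_L1[of \<phi> "\<lambda>i j. c * \<phi> i j", OF assms]
  unfolding tdiag_simps(3)[symmetric] by simp

lemma tdiag_L2_scale:
  assumes "\<And>i j. \<phi> i j = c * \<phi> i (Suc j)"
  shows "tdiag \<phi> ** L2 = c *\<^sub>R (L2 ** tdiag \<phi>)"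
  using tdiag_L2[of \<phi> "\<lambda>i j. c * \<phi> i j", OF assms]
  unfolding tdiag_simps(3)[symmetric] by simp

text \<open>Up to diagonal factors and multiples of the identity, \<open>Phi\<close>, \<open>Psi1\<close> and \<open>Psi2\<close> are \<open>Omega0\<close>,
  \<open>Omega1\<close> and \<open>Omega2\<close>.\<close>

definition Phi :: "complex^'v set^'v set"
  where "Phi = (real q - 1) *\<^sub>R F_zero + tdiag (\<lambda>i j. real q ^ j + real q ^ k / real q ^ i - 1)"

definition Psi1 :: "complex^'v set^'v set"
  where "Psi1 = (real q - 1) *\<^sub>R (real q *\<^sub>R F_zero + (real q - 1) *\<^sub>R F_minus)
    + tdiag (\<lambda>i j. real q * real q ^ k / real q ^ i + real q * real q ^ i * real q ^ j - real q)"

definition Psi2 :: "complex^'v set^'v set"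
  where "Psi2 = (real q - 1) *\<^sub>R (real q *\<^sub>R F_zero + (real q - 1) *\<^sub>R F_plus)
    + tdiag (\<lambda>i j. real q * real q ^ j + real q * real q ^ (h + k) / (real q ^ i * real q ^ j) - real q)"

text \<open>Two expressions for each of the three matrices. Those for \<open>Phi\<close> use the indices 2 and 1 respectively;
  those for \<open>Psi1\<close> and for \<open>Psi2\<close> differ in the order of the two factors, and their diagonal parts
  are related by one step of \<open>L\<^sub>1\<close> and of \<open>L\<^sub>2\<close>.\<close>

lemma Phi_eq_backslash:
  "Phi = (real q - 1) *\<^sub>R (R2 ** L2) - (real q - 1) *\<^sub>R (L2 ** R2)
    + tdiag (\<lambda>i j. real q ^ (h + k) / (real q ^ i * real q ^ j))"
  unfolding Phi_def R2_L2 L2_R2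
  by (auto simp: vec_eq_iff tdiag_entry scaleR_conv_of_real[where 'a=complex] algebra_simps)

lemma Phi_eq_slash:
  "Phi = (real q - 1) *\<^sub>R (L1 ** R1) - (real q - 1) *\<^sub>R (R1 ** L1)
    + tdiag (\<lambda>i j. real q ^ i * real q ^ j)"
  unfolding Phi_def L1_R1 R1_L1
  by (auto simp: vec_eq_iff tdiag_entry scaleR_conv_of_real[where 'a=complex] algebra_simps)

lemma Psi1_eq_L1_R1:
  "Psi1 = Phi + (real q - 1) *\<^sub>R ((real q - 1) *\<^sub>R (L1 ** R1))
    + tdiag (\<lambda>i j. real q * real q ^ i * real q ^ j - real q ^ j)"
  unfolding Phi_def Psi1_def L1_R1
  by (auto simp: vec_eq_iff tdiag_entry scaleR_conv_of_real[where 'a=complex] algebra_simps diff_divide_distrib)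

lemma Psi1_eq_R1_L1:
  "Psi1 = real q *\<^sub>R Phi + (real q - 1) *\<^sub>R ((real q - 1) *\<^sub>R (R1 ** L1))
    + tdiag (\<lambda>i j. real q ^ i * real q ^ j - real q ^ j)"
  unfolding Phi_def Psi1_def R1_L1
  by (auto simp: vec_eq_iff tdiag_entry scaleR_conv_of_real[where 'a=complex] algebra_simps diff_divide_distrib)

lemma Psi2_eq_L2_R2:
  "Psi2 = real q *\<^sub>R Phi + (real q - 1) *\<^sub>R ((real q - 1) *\<^sub>R (L2 ** R2))
    + tdiag (\<lambda>i j. real q ^ (h + k) / (real q ^ i * real q ^ j) - real q ^ k / real q ^ i)"
  unfolding Phi_def Psi2_def L2_R2
  by (auto simp: vec_eq_iff tdiag_entry scaleR_conv_of_real[where 'a=complex] algebra_simps diff_divide_distrib)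

lemma Psi2_eq_R2_L2:
  "Psi2 = Phi + (real q - 1) *\<^sub>R ((real q - 1) *\<^sub>R (R2 ** L2))
    + tdiag (\<lambda>i j. real q * real q ^ (h + k) / (real q ^ i * real q ^ j) - real q ^ k / real q ^ i)"
  unfolding Phi_def Psi2_def R2_L2
  by (auto simp: vec_eq_iff tdiag_entry scaleR_conv_of_real[where 'a=complex] algebra_simps diff_divide_distrib)

text \<open>In the form with \<open>R\<^sub>2 L\<^sub>2\<close> and \<open>L\<^sub>2 R\<^sub>2\<close>, the matrix \<open>L\<^sub>1\<close> commutes with \<open>R\<^sub>2\<close>, and picks up a factor
  \<open>q\<close> from \<open>L\<^sub>2\<close>. The same factor comes from the diagonal part, whose entries are
  \<open>q^(h + k - dim u)\<close>.\<close>

lemma Phi_L1: "Phi ** L1 = real q *\<^sub>R (L1 ** Phi)"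
proof -
  have a: "R2 ** L2 ** L1 = real q *\<^sub>R (L1 ** (R2 ** L2))"
    using L2_L1 L1_R2 by (metis matrix_mul_assoc matrix_mult_scaleR(2))
  have b: "L2 ** R2 ** L1 = real q *\<^sub>R (L1 ** (L2 ** R2))"
    using L2_L1 L1_R2 by (metis matrix_mul_assoc matrix_mult_scaleR(1))
  have c: "tdiag (\<lambda>i j. real q ^ (h + k) / (real q ^ i * real q ^ j)) ** L1
    = real q *\<^sub>R (L1 ** tdiag (\<lambda>i j. real q ^ (h + k) / (real q ^ i * real q ^ j)))"
    by (rule tdiag_L1_scale) (use q_ne_0 in \<open>simp add: field_simps\<close>)
  show ?thesis
    unfolding Phi_eq_backslash
    by (simp add: matrix_mult_distribs a b c scaleR_add_right scaleR_diff_right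
        mult.commute[of "real q - 1" "real q"] mult.commute[of "real q - 1" "inverse (real q)"])
qed

lemma Phi_L2: "Phi ** L2 = inverse (real q) *\<^sub>R (L2 ** Phi)"
proof -
  have L1_L2: "L1 ** L2 = inverse (real q) *\<^sub>R (L2 ** L1)" using L2_L1 q_ne_0 by simp
  have a: "R1 ** L1 ** L2 = inverse (real q) *\<^sub>R (L2 ** (R1 ** L1))"
    using L1_L2 R1_L2 by (metis matrix_mul_assoc matrix_mult_scaleR(2))
  have b: "L1 ** R1 ** L2 = inverse (real q) *\<^sub>R (L2 ** (L1 ** R1))"
    using L1_L2 R1_L2 by (metis matrix_mul_assoc matrix_mult_scaleR(1))
  have c: "tdiag (\<lambda>i j. real q ^ i * real q ^ j) ** L2
    = inverse (real q) *\<^sub>R (L2 ** tdiag (\<lambda>i j. real q ^ i * real q ^ j))"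
    by (rule tdiag_L2_scale) (use q_ne_0 in \<open>simp add: field_simps\<close>)
  show ?thesis
    unfolding Phi_eq_slash
    by (simp add: matrix_mult_distribs a b c scaleR_add_right scaleR_diff_right
        mult.commute[of "real q - 1" "real q"] mult.commute[of "real q - 1" "inverse (real q)"])
qed

text \<open>The Casimir argument: in \<open>(L\<^sub>1 R\<^sub>1) L\<^sub>1 = L\<^sub>1 (R\<^sub>1 L\<^sub>1)\<close> the left side is part of \<open>Psi1 ** L1\<close> by the
  first expression for \<open>Psi1\<close>, and the right side part of \<open>L1 ** Psi1\<close> by the second.
  The terms with \<open>Phi\<close> agree by \<open>Phi_L1\<close>.\<close>

lemma Psi1_L1: "Psi1 ** L1 = L1 ** Psi1"
proof -
  have c: "tdiag (\<lambda>i j. real q * real q ^ i * real q ^ j - real q ^ j) ** L1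
    = L1 ** tdiag (\<lambda>i j. real q ^ i * real q ^ j - real q ^ j)"
    by (rule tdiag_L1) simp
  have "Psi1 ** L1 = Phi ** L1 + (real q - 1) *\<^sub>R ((real q - 1) *\<^sub>R (L1 ** (R1 ** L1)))
    + L1 ** tdiag (\<lambda>i j. real q ^ i * real q ^ j - real q ^ j)"
    unfolding Psi1_eq_L1_R1 by (simp add: matrix_mult_distribs c matrix_mul_assoc)
  also have "\<dots> = L1 ** Psi1"
    unfolding Psi1_eq_R1_L1 by (simp add: matrix_mult_distribs Phi_L1)
  finally show ?thesis .
qed

lemma Psi1_L2: "Psi1 ** L2 = inverse (real q) *\<^sub>R (L2 ** Psi1)"
proof -
  have L1_L2: "L1 ** L2 = inverse (real q) *\<^sub>R (L2 ** L1)" using L2_L1 q_ne_0 by simp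
  have b: "L1 ** R1 ** L2 = inverse (real q) *\<^sub>R (L2 ** (L1 ** R1))"
    using L1_L2 R1_L2 by (metis matrix_mul_assoc matrix_mult_scaleR(1))
  have c: "tdiag (\<lambda>i j. real q * real q ^ i * real q ^ j - real q ^ j) ** L2
    = inverse (real q) *\<^sub>R (L2 ** tdiag (\<lambda>i j. real q * real q ^ i * real q ^ j - real q ^ j))"
    by (rule tdiag_L2_scale) (use q_ne_0 in \<open>simp add: field_simps\<close>)
  show ?thesis
    unfolding Psi1_eq_L1_R1
    by (simp add: matrix_mult_distribs b c Phi_L2 scaleR_add_right scaleR_diff_right
        mult.commute[of "real q - 1" "real q"] mult.commute[of "real q - 1" "inverse (real q)"])
qed

lemma Psi2_L2: "Psi2 ** L2 = L2 ** Psi2"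
proof -
  have c: "tdiag (\<lambda>i j. real q ^ (h + k) / (real q ^ i * real q ^ j) - real q ^ k / real q ^ i) ** L2
    = L2 ** tdiag (\<lambda>i j. real q * real q ^ (h + k) / (real q ^ i * real q ^ j) - real q ^ k / real q ^ i)"
    by (rule tdiag_L2) (use q_ne_0 in simp)
  have "Psi2 ** L2 = real q *\<^sub>R (Phi ** L2) + (real q - 1) *\<^sub>R ((real q - 1) *\<^sub>R (L2 ** (R2 ** L2)))
    + L2 ** tdiag (\<lambda>i j. real q * real q ^ (h + k) / (real q ^ i * real q ^ j) - real q ^ k / real q ^ i)"
    unfolding Psi2_eq_L2_R2 by (simp add: matrix_mult_distribs c matrix_mul_assoc)
  also have "\<dots> = L2 ** Psi2"
    unfolding Psi2_eq_R2_L2 using q_ne_0 by (simp add: matrix_mult_distribs Phi_L2)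
  finally show ?thesis .
qed

lemma Psi2_L1: "Psi2 ** L1 = real q *\<^sub>R (L1 ** Psi2)"
proof -
  have b: "L2 ** R2 ** L1 = real q *\<^sub>R (L1 ** (L2 ** R2))"
    using L2_L1 L1_R2 by (metis matrix_mul_assoc matrix_mult_scaleR(1))
  have c: "tdiag (\<lambda>i j. real q ^ (h + k) / (real q ^ i * real q ^ j) - real q ^ k / real q ^ i) ** L1
    = real q *\<^sub>R (L1 ** tdiag (\<lambda>i j. real q ^ (h + k) / (real q ^ i * real q ^ j) - real q ^ k / real q ^ i))"
    by (rule tdiag_L1_scale) (use q_ne_0 in \<open>simp add: field_simps\<close>)
  show ?thesis
    unfolding Psi2_eq_L2_R2
    by (simp add: matrix_mult_distribs b c Phi_L1 scaleR_add_right scaleR_diff_right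
        mult.commute[of "real q - 1" "real q"] mult.commute[of "real q - 1" "inverse (real q)"])
qed

text \<open>Type-preserving matrices commute with all diagonal generators, and symmetric matrices that commute
  with \<open>L\<^sub>1, L\<^sub>2\<close> commute with their transposes.\<close>

definition balanced :: "complex^'v set^'v set \<Rightarrow> bool"
  where "balanced X \<longleftrightarrow> transpose X = X \<and>
    (\<forall>u v. X $ u $ v \<noteq> 0 \<longrightarrow> u \<in> P \<and> v \<in> P \<and> idx_i u = idx_i v \<and> idx_j u = idx_j v)"

lemma balanced_tdiag_commute: "balanced X \<Longrightarrow> X ** tdiag \<phi> = tdiag \<phi> ** X"
  by (simp add: vec_eq_iff tdiag_def diag_mult_entry balanced_def) (metis mult.commute)

lemma transpose_tdiag: "transpose (tdiag \<phi>) = tdiag \<phi>"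
  by (auto simp: vec_eq_iff transpose_def tdiag_entry)

lemma balanced_tdiag: "balanced (tdiag \<phi>)"
  by (simp add: balanced_def transpose_tdiag tdiag_entry)

lemma balanced_mult_tdiag:
  assumes "balanced X"
  shows "balanced (X ** tdiag \<phi>)"
proof -
  have "transpose (X ** tdiag \<phi>) = tdiag \<phi> ** X"
    using assms by (simp add: matrix_transpose_mul transpose_tdiag balanced_def)
  then have "transpose (X ** tdiag \<phi>) = X ** tdiag \<phi>" using balanced_tdiag_commute[OF assms] by simp
  then show ?thesis
    using assms unfolding balanced_def by (auto simp: tdiag_def diag_mult_entry split: if_splits)
qed

lemma balanced_add: "balanced X \<Longrightarrow> balanced Y \<Longrightarrow> balanced (X + Y)"
  unfolding balanced_def by (simp add: transpose_def vec_eq_iff) (metis add.right_neutral)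

lemma balanced_scaleR: "balanced X \<Longrightarrow> balanced (c *\<^sub>R X)"
  unfolding balanced_def by (auto simp: transpose_scalar)

lemma balanced_rel_mat:
  assumes "\<And>u v. r u v \<Longrightarrow> r v u"
    and "\<And>u v. r u v \<Longrightarrow> idx_i u = idx_i v \<and> idx_j u = idx_j v"
  shows "balanced (rel_mat r)"
  using assms unfolding balanced_def by (auto simp: rel_mat_entry transpose_def vec_eq_iff)

lemma balanced_F: "balanced F_zero" "balanced F_plus" "balanced F_minus"
proof -
  have comm: "sum_space u v = sum_space v u" for u v
    by (auto simp: sum_space_def intro: add.commute)
  show "balanced F_zero" unfolding F_zero_def
    by (rule balanced_rel_mat) (metis comm Int_commute, metis backslash_covers_idx)
  show "balanced F_plus" unfolding F_plus_def
    by (rule balanced_rel_mat) (metis comm, metis backslash_covers_idx nat.inject)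
  show "balanced F_minus" unfolding F_minus_def
    by (rule balanced_rel_mat) (metis Int_commute, metis slash_covers_idx)
qed

lemma balanced_Phi: "balanced Phi" and balanced_Psi1: "balanced Psi1" and balanced_Psi2: "balanced Psi2"
  unfolding Phi_def Psi1_def Psi2_def
  by (intro balanced_add balanced_scaleR balanced_tdiag balanced_F)+

section \<open>The algebra H and the centre of its block part\<close>

lemma Id_P_tdiag: "Id_P = tdiag (\<lambda>i j. 1)"
  by (simp add: Id_P_def tdiag_def)

lemma Id_P_mult: "A \<in> MatP \<Longrightarrow> Id_P ** A = A" "A \<in> MatP \<Longrightarrow> A ** Id_P = A"
  by (auto simp: vec_eq_iff Id_P_def diag_mult_entry MatP_def)

lemma balanced_MatP: "balanced X \<Longrightarrow> X \<in> MatP"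
  by (auto simp: balanced_def MatP_def)

lemma MatP_mult: "A \<in> MatP \<Longrightarrow> B \<in> MatP \<Longrightarrow> A ** B \<in> MatP"
proof -
  assume AB: "A \<in> MatP" "B \<in> MatP"
  have "u \<in> P \<and> v \<in> P" if "(A ** B) $ u $ v \<noteq> 0" for u v
  proof -
    have "(\<Sum>w\<in>UNIV. A $ u $ w * B $ w $ v) \<noteq> 0"
      using that by (simp add: matrix_matrix_mult_def)
    then obtain w where "A $ u $ w * B $ w $ v \<noteq> 0" by (auto elim: sum.not_neutral_contains_not_neutral)
    then show ?thesis using AB by (auto simp: MatP_def)
  qed
  then show "A ** B \<in> MatP" by (simp add: MatP_def)
qed

lemma cscale_mult: "cscale c A ** B = cscale c (A ** B)" "A ** cscale c B = cscale c (A ** B)"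
  by (simp_all add: cscale_def vec_eq_iff matrix_matrix_mult_def sum_distrib_left mult_ac)

lemma MatP_closed: "A \<in> MatP \<Longrightarrow> B \<in> MatP \<Longrightarrow> A + B \<in> MatP" "A \<in> MatP \<Longrightarrow> cscale c A \<in> MatP"
proof -
  have nz: "a \<noteq> 0 \<or> b \<noteq> 0" if "a + b \<noteq> 0" for a b :: complex using that by auto
  show "A \<in> MatP \<Longrightarrow> B \<in> MatP \<Longrightarrow> A + B \<in> MatP" unfolding MatP_def using nz by fastforce
  show "A \<in> MatP \<Longrightarrow> cscale c A \<in> MatP" by (auto simp: MatP_def cscale_def)
qed

lemma subalgebra_commutant:
  assumes "X \<in> MatP"
  shows "subalgebra_P {A \<in> MatP. X ** A = A ** X}"
proof -
  have "X ** (A ** B) = (A ** B) ** X" if "X ** A = A ** X" "X ** B = B ** X" for A B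
    using that by (metis matrix_mul_assoc)
  then show ?thesis
    unfolding subalgebra_P_def
    using Id_P_mult[OF assms] balanced_MatP[OF balanced_tdiag]
    by (auto simp: Id_P_tdiag[symmetric] MatP_closed MatP_mult matrix_mult_distribs cscale_mult
        intro: balanced_MatP[OF balanced_tdiag, of "\<lambda>i j. 1", folded Id_P_tdiag])
qed

lemma K_tdiag:
  "K1 = tdiag (\<lambda>i j. qp (k / 2) / real q ^ i)" "K1inv = tdiag (\<lambda>i j. real q ^ i / qp (k / 2))"
  "K2 = tdiag (\<lambda>i j. real q ^ j / qp (h / 2))" "K2inv = tdiag (\<lambda>i j. qp (h / 2) / real q ^ j)"
  using q_pos
  by (simp_all add: K1_def K1inv_def K2_def K2inv_def tdiag_def powr_diff powr_realpow)

lemma Estar_tdiag: "Estar l = tdiag (\<lambda>i j. if i + j = l then 1 else 0)"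
  by (simp add: Estar_def tdiag_def dim_eq_idx)

lemma generators_MatP: "{L1, L2, R1, R2, K1, K1inv, K2, K2inv} \<subseteq> MatP"
  using balanced_MatP[OF balanced_tdiag]
  by (auto simp: K_tdiag) (auto simp: MatP_def L1_def L2_def R1_rel R2_rel rel_mat_entry split: if_splits)

text \<open>The hull is an intersection of subalgebras, hence a subalgebra, provided that there is at least one
  subalgebra containing the generators; the full matrix algebra is one.\<close>

lemma H_alg_subalgebra: "subalgebra_P H_alg"
proof -
  have Id: "Id_P \<in> MatP" unfolding Id_P_tdiag by (rule balanced_MatP[OF balanced_tdiag])
  have "subalgebra_P MatP"
    unfolding subalgebra_P_def using MatP_closed MatP_mult Id by auto
  then have "H_alg \<subseteq> MatP"
    unfolding H_alg_def by (rule hull_minimal[OF generators_MatP])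
  then show ?thesis
    unfolding H_alg_def hull_def subalgebra_P_def by blast
qed

lemma H_alg_generators: "{L1, L2, R1, R2, K1, K1inv, K2, K2inv} \<subseteq> H_alg"
  unfolding H_alg_def by (rule hull_subset)

lemma H_alg_MatP: "A \<in> H_alg \<Longrightarrow> A \<in> MatP"
  using H_alg_subalgebra by (auto simp: subalgebra_P_def)

lemma H_alg_Id: "Id_P \<in> H_alg"
  and H_alg_add: "A \<in> H_alg \<Longrightarrow> B \<in> H_alg \<Longrightarrow> A + B \<in> H_alg"
  and H_alg_mult: "A \<in> H_alg \<Longrightarrow> B \<in> H_alg \<Longrightarrow> A ** B \<in> H_alg"
  using H_alg_subalgebra by (simp_all add: subalgebra_P_def)

lemma H_alg_scaleR: "A \<in> H_alg \<Longrightarrow> c *\<^sub>R A \<in> H_alg"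
proof -
  have "c *\<^sub>R A = cscale (of_real c) A"
    by (simp add: cscale_def vec_eq_iff scaleR_conv_of_real[where 'a=complex])
  then show "A \<in> H_alg \<Longrightarrow> c *\<^sub>R A \<in> H_alg" using H_alg_subalgebra by (simp add: subalgebra_P_def)
qed

lemma H_alg_diff: "A \<in> H_alg \<Longrightarrow> B \<in> H_alg \<Longrightarrow> A - B \<in> H_alg"
  using H_alg_add[of A "(-1) *\<^sub>R B"] H_alg_scaleR[of B "-1"] by simp

lemma commutes_with_H_alg:
  assumes "balanced X" "X ** L1 = L1 ** X" "X ** L2 = L2 ** X" "A \<in> H_alg"
  shows "X ** A = A ** X"
proof -
  have tX: "transpose X = X" using assms by (simp add: balanced_def)
  have "transpose (X ** L1) = transpose (L1 ** X)" "transpose (X ** L2) = transpose (L2 ** X)"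
    using assms(2,3) by simp_all
  then have "X ** R1 = R1 ** X" "X ** R2 = R2 ** X"
    by (simp_all add: matrix_transpose_mul tX R1_def R2_def)
  then have "{L1, L2, R1, R2, K1, K1inv, K2, K2inv} \<subseteq> {A \<in> MatP. X ** A = A ** X}"
    using assms generators_MatP balanced_tdiag_commute[OF assms(1)] by (simp add: K_tdiag)
  then have "H_alg \<subseteq> {A \<in> MatP. X ** A = A ** X}"
    unfolding H_alg_def
    by (rule hull_minimal) (rule subalgebra_commutant[OF balanced_MatP[OF assms(1)]])
  then show ?thesis using assms(4) by blast
qed

lemma tdiag_H_alg_const: "tdiag (\<lambda>i j. c) \<in> H_alg"
  using H_alg_scaleR[OF H_alg_Id, of c] by (simp add: Id_P_tdiag tdiag_simps)

lemma qp_pos: "qp e > 0"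
  using q_pos by simp

lemma tdiag_H_alg_powers:
  "tdiag (\<lambda>i j. real q ^ i) \<in> H_alg" "tdiag (\<lambda>i j. inverse (real q ^ i)) \<in> H_alg"
  "tdiag (\<lambda>i j. real q ^ j) \<in> H_alg" "tdiag (\<lambda>i j. inverse (real q ^ j)) \<in> H_alg"
proof -
  have *: "tdiag \<psi> \<in> H_alg" if "tdiag \<phi> \<in> H_alg" "\<And>i j. \<psi> i j = c * \<phi> i j" for \<phi> \<psi> c
  proof -
    have "tdiag \<psi> = c *\<^sub>R tdiag \<phi>" unfolding tdiag_simps that(2) ..
    then show ?thesis using H_alg_scaleR[OF that(1)] by simp
  qed
  have g: "K1 \<in> H_alg" "K1inv \<in> H_alg" "K2 \<in> H_alg" "K2inv \<in> H_alg" using H_alg_generators by auto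
  have nz: "qp (k / 2) \<noteq> 0" "qp (h / 2) \<noteq> 0" using qp_pos by (metis less_irrefl)+
  show "tdiag (\<lambda>i j. real q ^ i) \<in> H_alg"
    by (rule *[OF g(2)[unfolded K_tdiag], of _ "qp (k / 2)"]) (use nz in \<open>simp add: field_simps\<close>)
  show "tdiag (\<lambda>i j. inverse (real q ^ i)) \<in> H_alg"
    by (rule *[OF g(1)[unfolded K_tdiag], of _ "1 / qp (k / 2)"]) (use nz in \<open>simp add: field_simps\<close>)
  show "tdiag (\<lambda>i j. real q ^ j) \<in> H_alg"
    by (rule *[OF g(3)[unfolded K_tdiag], of _ "qp (h / 2)"]) (use nz in \<open>simp add: field_simps\<close>)
  show "tdiag (\<lambda>i j. inverse (real q ^ j)) \<in> H_alg"
    by (rule *[OF g(4)[unfolded K_tdiag], of _ "1 / qp (h / 2)"]) (use nz in \<open>simp add: field_simps\<close>)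
qed

lemma tdiag_H_alg_arith:
  assumes "tdiag \<phi> \<in> H_alg" "tdiag \<psi> \<in> H_alg"
  shows "tdiag (\<lambda>i j. \<phi> i j + \<psi> i j) \<in> H_alg" "tdiag (\<lambda>i j. \<phi> i j - \<psi> i j) \<in> H_alg"
    "tdiag (\<lambda>i j. \<phi> i j * \<psi> i j) \<in> H_alg"
  using H_alg_add[OF assms] H_alg_diff[OF assms] H_alg_mult[OF assms]
  by (simp_all add: tdiag_simps tdiag_mult)

lemma Phi_H_alg: "Phi \<in> H_alg"
proof -
  have "tdiag (\<lambda>i j. real q ^ i * real q ^ j) \<in> H_alg"
    by (rule tdiag_H_alg_arith(3)[OF tdiag_H_alg_powers(1,3)])
  then show ?thesis
    unfolding Phi_eq_slash using H_alg_generators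
    by (intro H_alg_add H_alg_diff H_alg_scaleR H_alg_mult) auto
qed

lemma Psi1_H_alg: "Psi1 \<in> H_alg"
proof -
  have "tdiag (\<lambda>i j. real q * real q ^ i * real q ^ j - real q ^ j) \<in> H_alg"
    by (intro tdiag_H_alg_arith(2,3) tdiag_H_alg_powers) (rule tdiag_H_alg_const)
  then show ?thesis
    unfolding Psi1_eq_L1_R1 using H_alg_generators Phi_H_alg
    by (intro H_alg_add H_alg_diff H_alg_scaleR H_alg_mult) auto
qed

lemma Psi2_H_alg: "Psi2 \<in> H_alg"
proof -
  have "tdiag (\<lambda>i j. real q ^ (h + k) * (inverse (real q ^ i) * inverse (real q ^ j))
      - real q ^ k * inverse (real q ^ i)) \<in> H_alg"
    by (intro tdiag_H_alg_arith(2,3) tdiag_H_alg_powers(2,4)) (rule tdiag_H_alg_const)+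
  then have "tdiag (\<lambda>i j. real q ^ (h + k) / (real q ^ i * real q ^ j) - real q ^ k / real q ^ i) \<in> H_alg"
    by (simp only: divide_inverse inverse_mult_distrib)
  then show ?thesis
    unfolding Psi2_eq_L2_R2 using H_alg_generators Phi_H_alg
    by (intro H_alg_add H_alg_diff H_alg_scaleR H_alg_mult) auto
qed

text \<open>Both conditions are inherited by products and linear combinations, so centrality passes from a few
  matrices to the polynomials in them.\<close>

definition block_centre :: "(complex^'v set^'v set) set"
  where "block_centre = {X \<in> H_alg. \<forall>A\<in>H_alg. \<forall>l.
    X ** (Estar l ** A ** Estar l) = (Estar l ** A ** Estar l) ** X}"

lemma block_centre_add: "X \<in> block_centre \<Longrightarrow> Y \<in> block_centre \<Longrightarrow> X + Y \<in> block_centre"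
  by (simp add: block_centre_def H_alg_add matrix_mult_distribs)

lemma block_centre_diff: "X \<in> block_centre \<Longrightarrow> Y \<in> block_centre \<Longrightarrow> X - Y \<in> block_centre"
  by (simp add: block_centre_def H_alg_diff matrix_mult_distribs)

lemma block_centre_scaleR: "X \<in> block_centre \<Longrightarrow> c *\<^sub>R X \<in> block_centre"
  by (simp add: block_centre_def H_alg_scaleR)

lemma block_centre_uminus: "X \<in> block_centre \<Longrightarrow> - X \<in> block_centre"
  using block_centre_scaleR[of X "-1"] by simp

lemma block_centre_mult: "X \<in> block_centre \<Longrightarrow> Y \<in> block_centre \<Longrightarrow> X ** Y \<in> block_centre"
proof -
  have "(X ** Y) ** B = B ** (X ** Y)" if "X ** B = B ** X" "Y ** B = B ** Y" for B
    using that by (metis matrix_mul_assoc)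
  then show "X \<in> block_centre \<Longrightarrow> Y \<in> block_centre \<Longrightarrow> X ** Y \<in> block_centre"
    by (simp add: block_centre_def H_alg_mult)
qed

lemma block_centreI:
  assumes "X \<in> H_alg" "balanced X" "X ** L1 = L1 ** X" "X ** L2 = L2 ** X"
  shows "X \<in> block_centre"
proof -
  have "X ** (Estar l ** A ** Estar l) = (Estar l ** A ** Estar l) ** X" if "A \<in> H_alg" for A l
  proof -
    have XA: "X ** A = A ** X" by (rule commutes_with_H_alg[OF assms(2-4) that])
    have XE: "X ** Estar l = Estar l ** X" unfolding Estar_tdiag by (rule balanced_tdiag_commute[OF assms(2)])
    have "X ** (Estar l ** A ** Estar l) = (X ** Estar l) ** A ** Estar l" by (simp only: matrix_mul_assoc)
    also have "\<dots> = Estar l ** (X ** A) ** Estar l" unfolding XE by (simp only: matrix_mul_assoc)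
    also have "\<dots> = Estar l ** A ** (X ** Estar l)" unfolding XA by (simp only: matrix_mul_assoc)
    also have "\<dots> = (Estar l ** A ** Estar l) ** X" unfolding XE by (simp only: matrix_mul_assoc)
    finally show ?thesis .
  qed
  then show ?thesis using assms(1) by (simp add: block_centre_def)
qed

text \<open>A matrix that is a function of the dimension acts on each block \<open>E\<^sub>l\<close> as a scalar.\<close>

lemma block_centre_dim_diag:
  assumes "tdiag (\<lambda>i j. f (i + j)) \<in> H_alg"
  shows "tdiag (\<lambda>i j. f (i + j)) \<in> block_centre"
proof -
  let ?D = "tdiag (\<lambda>i j. f (i + j))"
  have E: "?D ** Estar l = f l *\<^sub>R Estar l" "Estar l ** ?D = f l *\<^sub>R Estar l" for l
    unfolding Estar_tdiag tdiag_mult tdiag_simps by (auto simp: fun_eq_iff intro!: arg_cong[of _ _ tdiag])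
  have "?D ** (Estar l ** A ** Estar l) = (Estar l ** A ** Estar l) ** ?D" for A l
  proof -
    have "?D ** (Estar l ** A ** Estar l) = (?D ** Estar l) ** A ** Estar l"
      by (simp only: matrix_mul_assoc)
    also have "\<dots> = Estar l ** A ** (Estar l ** ?D)" unfolding E by simp
    finally show ?thesis by (simp only: matrix_mul_assoc)
  qed
  then show ?thesis using assms by (simp add: block_centre_def)
qed

lemma sum_Estar: "(\<Sum>l\<le>h + k. Estar l) = Id_P"
proof -
  have "(\<Sum>l\<le>n. Estar l) = tdiag (\<lambda>i j. if i + j \<le> n then 1 else 0)" for n
    by (induction n) (auto simp: Estar_tdiag tdiag_simps simp: fun_eq_iff intro!: arg_cong[of _ _ tdiag])
  then show ?thesis
    using dim_le by (auto simp: Id_P_tdiag vec_eq_iff tdiag_entry dim_eq_idx)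
qed

text \<open>Taking \<open>A\<close> to be the identity shows that a member \<open>X\<close> of \<open>block_centre\<close> commutes with each \<open>E\<^sub>l\<close>.
  As the \<open>E\<^sub>l\<close> sum to the identity, \<open>X\<close> is the sum of its own blocks.\<close>

lemma block_centre_H_bar:
  assumes "X \<in> block_centre"
  shows "X \<in> H_bar \<and> (\<forall>A\<in>H_bar. X ** A = A ** X)"
proof
  have X: "X \<in> H_alg" using assms by (simp add: block_centre_def)
  have EE: "Estar l ** Estar l = Estar l" for l
    unfolding Estar_tdiag tdiag_mult by (auto simp: fun_eq_iff intro!: arg_cong[of _ _ tdiag])
  have "Estar l ** Id_P ** Estar l = Estar l" for l
    unfolding Id_P_tdiag Estar_tdiag tdiag_mult by (auto simp: fun_eq_iff intro!: arg_cong[of _ _ tdiag])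
  then have c: "X ** Estar l = Estar l ** X" for l
    using assms H_alg_Id unfolding block_centre_def by (metis (mono_tags, lifting) mem_Collect_eq)
  have "X = X ** (\<Sum>l\<le>h + k. Estar l)"
    unfolding sum_Estar using Id_P_mult H_alg_MatP[OF X] by simp
  also have "\<dots> = (\<Sum>l\<le>h + k. Estar l ** X ** Estar l)"
    unfolding matrix_mult_sum_distrib c[symmetric] by (simp add: EE flip: matrix_mul_assoc)
  finally show "X \<in> H_bar" unfolding H_bar_def using X by (auto intro!: exI[of _ "\<lambda>l. X"])
  show "\<forall>A\<in>H_bar. X ** A = A ** X"
    using assms unfolding H_bar_def block_centre_def
    by (auto simp: matrix_mult_sum_distrib intro!: sum.cong)
qed

section \<open>Centrality of the Omega matrices\<close>

text \<open>All coefficients in the definitions of the \<open>\<Omega>\<close>s in terms of \<open>q^(h/2)\<close> and \<open>q^(k/2)\<close>, so that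
  comparing coefficients becomes a computation with rational functions.\<close>

lemma qp_coeffs:
  "qp (k / 2) * qp (k / 2) = real q ^ k" "qp (h / 2) * qp (h / 2) = real q ^ h"
  "qp (- real (h + k) / 2) = 1 / (qp (h / 2) * qp (k / 2))"
  "qp (- real h / 2) = 1 / qp (h / 2)" "qp (- real k / 2) = 1 / qp (k / 2)"
  "qp (k / 2 + 1) = qp (k / 2) * real q" "qp (h / 2 + 1) = qp (h / 2) * real q"
  "qp ((h + k) / 2 + 1) = qp (h / 2) * qp (k / 2) * real q"
proof -
  have k2: "qp (real k / 2) * qp (real k / 2) = real q ^ k" and h2: "qp (real h / 2) * qp (real h / 2) = real q ^ h"
    unfolding powr_add[symmetric] using powr_realpow[OF q_pos] by simp_all
  show "qp (k / 2) * qp (k / 2) = real q ^ k" "qp (h / 2) * qp (h / 2) = real q ^ h"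
    by (fact k2, fact h2)
  have "- real (h + k) / 2 = - (real h / 2 + real k / 2)" by (simp add: field_simps)
  then show "qp (- real (h + k) / 2) = 1 / (qp (h / 2) * qp (k / 2))"
    by (simp only: powr_minus powr_add inverse_eq_divide)
  have "- real h / 2 = - (real h / 2)" "- real k / 2 = - (real k / 2)" by simp_all
  then show "qp (- real h / 2) = 1 / qp (h / 2)" "qp (- real k / 2) = 1 / qp (k / 2)"
    by (simp_all only: powr_minus inverse_eq_divide)
  have q1: "qp 1 = real q" using q_pos by simp
  show "qp (k / 2 + 1) = qp (k / 2) * real q" "qp (h / 2 + 1) = qp (h / 2) * real q"
    by (simp_all only: powr_add q1)
  have "real (h + k) / 2 + 1 = real h / 2 + real k / 2 + 1" by (simp add: field_simps)
  then show "qp ((h + k) / 2 + 1) = qp (h / 2) * qp (k / 2) * real q"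
    by (simp only: powr_add q1)
qed

lemma mult_tdiag_assoc: "X ** tdiag \<phi> ** tdiag \<psi> = X ** tdiag (\<lambda>i j. \<phi> i j * \<psi> i j)"
  by (simp add: tdiag_mult flip: matrix_mul_assoc)

lemma mult_tdiag_scale:
  fixes X :: "complex^'v set^'v set"
  shows "c *\<^sub>R (X ** tdiag \<phi>) = X ** tdiag (\<lambda>i j. c * \<phi> i j)"
  unfolding tdiag_simps(3)[symmetric] by simp

lemma tdiag_combination_eq:
  assumes "\<And>i j. a i j = a' i j" "\<And>i j. b i j = b' i j" "\<And>i j. c i j = c' i j"
  shows "X ** tdiag a + Y ** tdiag b + tdiag c - Z = X ** tdiag a' + Y ** tdiag b' + tdiag c' - Z"
proof -
  have "a = a'" "b = b'" "c = c'" using assms by (auto simp: fun_eq_iff)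
  then show ?thesis by simp
qed

text \<open>Expanded, both sides are the same \<open>F\<close>s times diagonal matrices, plus a diagonal matrix; what is
  compared are the diagonal coefficients, as functions of \<open>i\<close> and \<open>j\<close>.\<close>

lemma Omega0_eq: "Omega0 = Phi ** tdiag (\<lambda>i j. real q ^ i / (real q ^ k * real q ^ j))"
proof -
  define s t where "s = qp (h / 2)" and "t = qp (k / 2)"
  have pos: "s \<noteq> 0" "t \<noteq> 0" using qp_pos unfolding s_def t_def by (metis less_irrefl)+
  have tt: "real q ^ k = t * t" using qp_coeffs(1) by (simp add: t_def)
  have group: "c *\<^sub>R (X + Y + Z - W) = c *\<^sub>R X + c *\<^sub>R (Y + Z - W)"
    for c and X Y Z W :: "complex^'v set^'v set"
    by (simp add: algebra_simps)
  show ?thesis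
    unfolding Omega0_def Phi_def K_tdiag qp_coeffs s_def[symmetric] t_def[symmetric] tt
      group matrix_mult_distribs matrix_mult_scaleR mult_tdiag_assoc tdiag_mult mult_tdiag_scale tdiag_simps
    using pos q_ne_0
    by (intro arg_cong2[of _ _ _ _ "(+)"] arg_cong[of _ _ tdiag]
        arg_cong[of _ _ "\<lambda>\<phi>. F_zero ** tdiag \<phi>"] ext)
      (simp_all add: field_simps)
qed

lemma Omega1_eq:
  "Omega1 = (1 / (real q - 1)) *\<^sub>R (Psi1 ** tdiag (\<lambda>i j. 1 / real q ^ j)) - (real q / (real q - 1)) *\<^sub>R Id_P"
proof -
  define s t where "s = qp (h / 2)" and "t = qp (k / 2)"
  have pos: "s \<noteq> 0" "t \<noteq> 0" using qp_pos unfolding s_def t_def by (metis less_irrefl)+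
  have tt: "real q ^ k = t * t" using qp_coeffs(1) by (simp add: t_def)
  have q1: "real q - 1 \<noteq> 0" using q_gt_1 by simp
  show ?thesis
    unfolding Omega1_def Psi1_def K_tdiag qp_coeffs s_def[symmetric] t_def[symmetric] tt Id_P_tdiag
      matrix_mult_distribs matrix_mult_scaleR scaleR_add_right mult_tdiag_assoc tdiag_mult mult_tdiag_scale tdiag_simps
    by (rule tdiag_combination_eq) (use pos q_ne_0 q1 in \<open>simp_all add: divide_simps\<close>, simp_all add: algebra_simps)
qed

lemma Omega2_eq:
  "Omega2 = (1 / (real q - 1)) *\<^sub>R (Psi2 ** tdiag (\<lambda>i j. real q ^ i / real q ^ k)) - (real q / (real q - 1)) *\<^sub>R Id_P"
proof -
  define s t where "s = qp (h / 2)" and "t = qp (k / 2)"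
  have pos: "s \<noteq> 0" "t \<noteq> 0" using qp_pos unfolding s_def t_def by (metis less_irrefl)+
  have tt: "real q ^ k = t * t" "real q ^ (h + k) = s * s * (t * t)"
    using qp_coeffs(1,2) by (simp_all add: t_def s_def power_add)
  have q1: "real q - 1 \<noteq> 0" using q_gt_1 by simp
  show ?thesis
    unfolding Omega2_def Psi2_def K_tdiag qp_coeffs s_def[symmetric] t_def[symmetric] tt Id_P_tdiag
      matrix_mult_distribs matrix_mult_scaleR scaleR_add_right mult_tdiag_assoc tdiag_mult mult_tdiag_scale tdiag_simps
    by (rule tdiag_combination_eq) (use pos q_ne_0 q1 in \<open>simp_all add: divide_simps\<close>)
qed

text \<open>A matrix that commutes with \<open>L\<^sub>1\<close> and \<open>L\<^sub>2\<close> up to scalars becomes central when multiplied by a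
  diagonal matrix with the inverse commutation factors.\<close>

lemma block_centre_twist:
  assumes "X \<in> H_alg" "balanced X" "tdiag \<phi> \<in> H_alg"
    and "X ** L1 = c *\<^sub>R (L1 ** X)" "\<And>i j. c * \<phi> i j = \<phi> (Suc i) j"
    and "X ** L2 = d *\<^sub>R (L2 ** X)" "\<And>i j. d * \<phi> i j = \<phi> i (Suc j)"
    and "c \<noteq> 0" "d \<noteq> 0"
  shows "X ** tdiag \<phi> \<in> block_centre"
proof (rule block_centreI)
  have e1: "\<phi> i j = inverse c * \<phi> (Suc i) j" and e2: "\<phi> i j = inverse d * \<phi> i (Suc j)" for i j
    using assms(8,9) unfolding assms(5,7)[symmetric] by simp_all
  show "X ** tdiag \<phi> ** L1 = L1 ** (X ** tdiag \<phi>)"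
    unfolding matrix_mul_assoc[symmetric] tdiag_L1_scale[of \<phi>, OF e1]
    using assms(8) by (simp add: matrix_mul_assoc assms(4))
  show "X ** tdiag \<phi> ** L2 = L2 ** (X ** tdiag \<phi>)"
    unfolding matrix_mul_assoc[symmetric] tdiag_L2_scale[of \<phi>, OF e2]
    using assms(9) by (simp add: matrix_mul_assoc assms(6))
qed (use assms in \<open>simp_all add: H_alg_mult balanced_mult_tdiag\<close>)

lemma Id_P_block_centre: "Id_P \<in> block_centre"
  using block_centre_dim_diag[of "\<lambda>l. 1"] H_alg_Id by (simp add: Id_P_tdiag)

lemma K_block_centre: "K1 ** K2inv \<in> block_centre" "K1inv ** K2 \<in> block_centre"
proof -
  have H: "K1 ** K2inv \<in> H_alg" "K1inv ** K2 \<in> H_alg"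
    using H_alg_generators by (auto intro: H_alg_mult)
  have "K1 ** K2inv = tdiag (\<lambda>i j. qp (k / 2) * qp (h / 2) / real q ^ (i + j))"
    "K1inv ** K2 = tdiag (\<lambda>i j. real q ^ (i + j) / (qp (k / 2) * qp (h / 2)))"
    by (simp_all add: K_tdiag tdiag_mult power_add)
  then show "K1 ** K2inv \<in> block_centre" "K1inv ** K2 \<in> block_centre"
    using H block_centre_dim_diag[of "\<lambda>l. qp (k / 2) * qp (h / 2) / real q ^ l"]
      block_centre_dim_diag[of "\<lambda>l. real q ^ l / (qp (k / 2) * qp (h / 2))"] by simp_all
qed

lemma Omega_block_centre:
  "Omega0 \<in> block_centre" "Omega1 \<in> block_centre" "Omega2 \<in> block_centre"
proof -
  have "tdiag (\<lambda>i j. real q ^ i * inverse (real q ^ j) * inverse (real q ^ k)) \<in> H_alg"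
    "tdiag (\<lambda>i j. real q ^ i * inverse (real q ^ k)) \<in> H_alg"
    by (intro tdiag_H_alg_arith(3) tdiag_H_alg_powers(1,4); rule tdiag_H_alg_const)+
  then have H: "tdiag (\<lambda>i j. real q ^ i / (real q ^ k * real q ^ j)) \<in> H_alg"
    "tdiag (\<lambda>i j. 1 / real q ^ j) \<in> H_alg"
    "tdiag (\<lambda>i j. real q ^ i / real q ^ k) \<in> H_alg"
    using tdiag_H_alg_powers(4) by (simp_all add: divide_inverse mult_ac)
  show "Omega0 \<in> block_centre"
    unfolding Omega0_eq
    by (rule block_centre_twist[OF Phi_H_alg balanced_Phi H(1) Phi_L1 _ Phi_L2])
      (use q_ne_0 in \<open>simp_all add: field_simps\<close>)
  have c: "Psi1 ** L1 = 1 *\<^sub>R (L1 ** Psi1)" "Psi2 ** L2 = 1 *\<^sub>R (L2 ** Psi2)"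
    by (simp_all add: Psi1_L1 Psi2_L2)
  have "Psi1 ** tdiag (\<lambda>i j. 1 / real q ^ j) \<in> block_centre"
    by (rule block_centre_twist[OF Psi1_H_alg balanced_Psi1 H(2) c(1) _ Psi1_L2])
      (use q_ne_0 in \<open>simp_all add: field_simps\<close>)
  then show "Omega1 \<in> block_centre"
    unfolding Omega1_eq by (intro block_centre_diff block_centre_scaleR Id_P_block_centre)
  have "Psi2 ** tdiag (\<lambda>i j. real q ^ i / real q ^ k) \<in> block_centre"
    by (rule block_centre_twist[OF Psi2_H_alg balanced_Psi2 H(3) Psi2_L1 _ c(2)])
      (use q_ne_0 in \<open>simp_all add: field_simps\<close>)
  then show "Omega2 \<in> block_centre"
    unfolding Omega2_eq by (intro block_centre_diff block_centre_scaleR Id_P_block_centre)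
qed

lemmas block_centre_closed = block_centre_add block_centre_diff block_centre_uminus
  block_centre_scaleR block_centre_mult Id_P_block_centre K_block_centre Omega_block_centre

lemma Ycal_block_centre: "Ycal \<in> block_centre"
  unfolding Ycal_def by (intro block_centre_closed)

lemma central_elements:
  "{Ycal, Pcal, Omega, G, Gstar} \<subseteq> block_centre"
proof -
  have "Pcal \<in> block_centre" unfolding Pcal_def by (intro block_centre_closed Ycal_block_centre)
  moreover have "Omega \<in> block_centre" unfolding Omega_def by (intro block_centre_closed)
  moreover have "G \<in> block_centre" unfolding G_def by (intro block_centre_closed Ycal_block_centre)
  moreover have "Gstar \<in> block_centre"
    unfolding Gstar_def matrix_mul_assoc[symmetric] by (intro block_centre_closed)
  ultimately show ?thesis using Ycal_block_centre by simp
qed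

end

theorem lemma7p2:
  fixes scale :: "'a::{field,finite} \<Rightarrow> 'v::{ab_group_add,finite} \<Rightarrow> 'v"
    and q h k :: nat
    and y :: "'v set"
  assumes "subspace_lattice scale q h k y"
  shows "\<forall>X \<in> {subspace_lattice.Ycal scale q h k y, subspace_lattice.Pcal scale q h k y,
      subspace_lattice.Omega scale q h k y, subspace_lattice.G scale q h k y,
      subspace_lattice.Gstar scale q h k y}.
    X \<in> subspace_lattice.H_bar scale q h k y \<and>
    (\<forall>A \<in> subspace_lattice.H_bar scale q h k y. X ** A = A ** X)"
proof -
  interpret subspace_lattice scale q h k y by fact
  show ?thesis using central_elements block_centre_H_bar by blast
qed

end
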